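(* Let $\Gamma=\langle f,g\rangle$ be a non-elementary discrete $\mathcal{RP}$ group without invariant plane. Let $\beta(g)=0$, and let either $\beta(f)=-4\sin^2(\pi/n)$ with $n\in\mathbb{Z}$, $n\geq 3$, or $\beta(f)\in[0,+\infty)$. Put $n=\infty$ if $\beta(f)=0$ and $n=\overline{\infty}$ if $\beta(f)\in(0,+\infty)$. 1. If $\gamma(f,g)\in(-\infty,-4)$, then $\Gamma$ is isomorphic to $GT[n,\infty;\overline{\infty}]$. 2. If $\gamma(f,g)=-4$, then $\Gamma$ is isomorphic to $GT[n,\infty;\infty]$. 3. If $\gamma(f,g)=-4\cos^2(\pi/p)$ with $p\geq 4$ an even integer, then $\Gamma$ is isomorphic to $GT[n,\infty;p/2]$. 4. If $\gamma(f,g)=-4\cos^2(\pi/p)$ with $p\geq 3$ an odd integer, then $\Gamma$ is isomorphic to $Tet[n,\infty;p]$.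
   Context: For $f,g\in\mathrm{PSL}(2,\mathbb{C})$ put $\beta(f)=\mathrm{tr}^2 f-4$, $\beta(g)=\mathrm{tr}^2 g-4$ and $\gamma(f,g)=\mathrm{tr}[f,g]-2$, where $[f,g]=fgf^{-1}g^{-1}$ (independent of the choice of lifts to $\mathrm{SL}(2,\mathbb{C})$). A two-generator group $\Gamma=\langle f,g\rangle$ is an $\mathcal{RP}$ group (group with real parameters) if $f,g\in\mathrm{PSL}(2,\mathbb{C})$ and $\beta(f),\beta(g),\gamma(f,g)\in\mathbb{R}$. $\mathrm{PSL}(2,\mathbb{C})$ acts on hyperbolic 3-space $\mathbb{H}^3$ by orientation-preserving isometries; "without invariant plane" means that no hyperbolic plane in $\mathbb{H}^3$ is mapped to itself by all elements of $\Gamma$. The symbols $\infty$ and $\overline{\infty}$ are two formal symbols. Define $$GT[n,m;q]=\langle f,g \mid f^n=g^m=[f,g]^q=1\rangle,\qquad n,m,q\in\{2,3,\dots\}\cup\{\infty,\overline{\infty}\},$$ $$Tet[n,m;q]=\langle x,y,z \mid x^2=y^2=z^n=(xy^{-1})^m=(yz^{-1})^2=(zx^{-1})^q=1\rangle,\qquad n,m,q\in\mathbb{Z}\cup\{\infty,\overline{\infty}\}.$$ Convention: a relation with exponent $\overline{\infty}$ is simply removed from the presentation. A relation with exponent $\infty$ may be kept to give a "Kleinian group presentation" (it records that the corresponding element is parabolic); to obtain the abstract group presentation, relations with exponent $\infty$ are removed as well. For example, $GT[n,\infty;\overline{\infty}]$ for an integer $n$ has Kleinian group presentation $\langle f,g\mid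 f^n=g^\infty=1\rangle$ and is isomorphic to $\mathbb{Z}_n*\mathbb{Z}$. *)

theory Defs
  imports "HOL-Analysis.Analysis" "HOL-Algebra.Coset" "HOL-Algebra.Generated_Groups"
begin

section \<open>The groups SL(2,C) and PSL(2,C)\<close>

type_synonym mat2 = "complex^2^2"

definition SL2C :: "mat2 monoid" where
  "SL2C = \<lparr>carrier = {A. det A = 1}, mult = (**), one = mat 1\<rparr>"

definition centre_SL2C :: "mat2 set" where
  "centre_SL2C = {mat 1, - mat 1}"

definition PSL2C :: "mat2 set monoid" where
  "PSL2C = SL2C Mod centre_SL2C"

lemma det_uminus2: "det (- A :: mat2) = det A"
  by (simp add: det_2)

lemma matrix_mul_uminus_left: "(- A) ** B = - (A ** (B :: mat2))"
  by (vector matrix_matrix_mult_def) (simp add: sum_negf)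

lemma matrix_mul_uminus_right: "A ** (- B) = - (A ** (B :: mat2))"
  by (vector matrix_matrix_mult_def) (simp add: sum_negf)

lemma group_SL2C: "group SL2C"
proof (rule groupI)
  fix A assume "A \<in> carrier SL2C"
  then have d: "det A = 1" by (simp add: SL2C_def)
  then obtain B where B: "A ** B = mat 1" "B ** A = mat 1"
    using invertible_det_nz[of A] by (auto simp: invertible_def)
  have "det B = 1" using det_mul[of B A] B d by simp
  then show "\<exists>B\<in>carrier SL2C. B \<otimes>\<^bsub>SL2C\<^esub> A = \<one>\<^bsub>SL2C\<^esub>"
    using B by (auto simp: SL2C_def)
qed (auto simp: SL2C_def det_mul matrix_mul_assoc)

lemma normal_centre_SL2C: "centre_SL2C \<lhd> SL2C"
proof -
  interpret group SL2C by (rule group_SL2C)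
  have s: "subgroup centre_SL2C SL2C"
  proof (rule subgroupI)
    fix a assume a: "a \<in> centre_SL2C"
    then have "a \<otimes>\<^bsub>SL2C\<^esub> a = \<one>\<^bsub>SL2C\<^esub>" "a \<in> carrier SL2C"
      by (auto simp: centre_SL2C_def SL2C_def matrix_mul_uminus_left
          matrix_mul_uminus_right det_uminus2)
    then have "inv\<^bsub>SL2C\<^esub> a = a" using inv_equality by blast
    with a show "inv\<^bsub>SL2C\<^esub> a \<in> centre_SL2C" by simp
  qed (auto simp: centre_SL2C_def SL2C_def matrix_mul_uminus_left
      matrix_mul_uminus_right det_uminus2)
  show ?thesis
    unfolding normal_inv_iff
  proof (intro conjI s ballI)
    fix x h assume x: "x \<in> carrier SL2C" and h: "h \<in> centre_SL2C"
    have "x \<otimes>\<^bsub>SL2C\<^esub> h = h \<otimes>\<^bsub>SL2C\<^esub> x"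
      using h by (auto simp: centre_SL2C_def SL2C_def matrix_mul_uminus_left
          matrix_mul_uminus_right)
    moreover have "h \<in> carrier SL2C" using s h subgroup.mem_carrier by fast
    ultimately have "x \<otimes>\<^bsub>SL2C\<^esub> h \<otimes>\<^bsub>SL2C\<^esub> inv\<^bsub>SL2C\<^esub> x = h"
      using x by (simp add: m_assoc)
    then show "x \<otimes>\<^bsub>SL2C\<^esub> h \<otimes>\<^bsub>SL2C\<^esub> inv\<^bsub>SL2C\<^esub> x \<in> centre_SL2C" using h by simp
  qed
qed

lemma group_PSL2C: "group PSL2C"
  unfolding PSL2C_def by (rule normal.factorgroup_is_group[OF normal_centre_SL2C])

definition proj_PSL :: "mat2 \<Rightarrow> mat2 set" where
  "proj_PSL A = centre_SL2C #>\<^bsub>SL2C\<^esub> A"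

lemma proj_PSL_eq: "proj_PSL A = {A, - A}"
  by (auto simp: proj_PSL_def r_coset_def centre_SL2C_def SL2C_def matrix_mul_uminus_left)

lemma carrier_PSL2C: "carrier PSL2C = proj_PSL ` carrier SL2C"
  by (auto simp: PSL2C_def FactGroup_def RCOSETS_def proj_PSL_def)

definition lift :: "mat2 set \<Rightarrow> mat2" where
  "lift h = (SOME A. A \<in> h)"

lemma lift_cases:
  assumes "h \<in> carrier PSL2C" "A \<in> h"
  shows "lift h = A \<or> lift h = - A"
proof -
  have "lift h \<in> h" unfolding lift_def using assms(2) by (rule someI)
  with assms show ?thesis by (auto simp: carrier_PSL2C proj_PSL_eq)
qed

lemma lift_in_carrier:
  assumes "h \<in> carrier PSL2C"
  shows "lift h \<in> carrier SL2C" "proj_PSL (lift h) = h"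
proof -
  obtain A where A: "A \<in> carrier SL2C" "h = {A, - A}"
    using assms by (auto simp: carrier_PSL2C proj_PSL_eq)
  then have "lift h = A \<or> lift h = - A" using lift_cases[OF assms, of A] by simp
  then show "lift h \<in> carrier SL2C" "proj_PSL (lift h) = h"
    using A by (auto simp: SL2C_def det_uminus2 proj_PSL_eq)
qed

section \<open>The parameters of a two-generator group\<close>

definition beta :: "mat2 set \<Rightarrow> complex" where
  "beta h = (trace (lift h))\<^sup>2 - 4"

definition gamma :: "mat2 set \<Rightarrow> mat2 set \<Rightarrow> complex" where
  "gamma f g =
     trace (lift f \<otimes>\<^bsub>SL2C\<^esub> lift g \<otimes>\<^bsub>SL2C\<^esub> inv\<^bsub>SL2C\<^esub> (lift f) \<otimes>\<^bsub>SL2C\<^esub> inv\<^bsub>SL2C\<^esub> (lift g)) - 2"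

lemma trace_uminus2: "trace (- A :: mat2) = - trace A"
  by (simp add: trace_def sum_negf)

lemma beta_lift_indep:
  assumes "h \<in> carrier PSL2C" "A \<in> h"
  shows "beta h = (trace A)\<^sup>2 - 4"
  using lift_cases[OF assms] by (auto simp: beta_def trace_uminus2)

lemma inv_uminus_SL2C:
  assumes "A \<in> carrier SL2C"
  shows "inv\<^bsub>SL2C\<^esub> (- A) = - (inv\<^bsub>SL2C\<^esub> A)"
proof -
  interpret group SL2C by (rule group_SL2C)
  have "(- (inv\<^bsub>SL2C\<^esub> A)) ** (- A) = mat 1"
    using l_inv[OF assms] by (simp add: SL2C_def matrix_mul_uminus_left matrix_mul_uminus_right)
  then show ?thesis
    using inv_equality[of "- (inv\<^bsub>SL2C\<^esub> A)" "- A"] assms inv_closed[OF assms]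
    by (auto simp: SL2C_def det_uminus2)
qed

lemma gamma_lift_indep:
  assumes "f \<in> carrier PSL2C" "A \<in> f" "g \<in> carrier PSL2C" "B \<in> g"
  shows "gamma f g =
    trace (A \<otimes>\<^bsub>SL2C\<^esub> B \<otimes>\<^bsub>SL2C\<^esub> inv\<^bsub>SL2C\<^esub> A \<otimes>\<^bsub>SL2C\<^esub> inv\<^bsub>SL2C\<^esub> B) - 2"
proof -
  have m: "X \<otimes>\<^bsub>SL2C\<^esub> Y = X ** Y" for X Y by (simp add: SL2C_def)
  have "A \<in> carrier SL2C" "B \<in> carrier SL2C"
    using assms by (auto simp: carrier_PSL2C proj_PSL_eq SL2C_def det_uminus2)
  then show ?thesis
    using lift_cases[OF assms(1,2)] lift_cases[OF assms(3,4)]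
    by (auto simp: gamma_def m inv_uminus_SL2C matrix_mul_uminus_left matrix_mul_uminus_right)
qed

section \<open>Discreteness\<close>

text \<open>The topology of PSL(2,C) is the quotient topology of the subspace topology of SL(2,C)
  in the space of complex 2x2 matrices.\<close>

definition PSL2C_topology :: "mat2 set topology" where
  "PSL2C_topology = topology (\<lambda>U. U \<subseteq> carrier PSL2C \<and>
     openin (top_of_set (carrier SL2C)) {A \<in> carrier SL2C. proj_PSL A \<in> U})"

lemma openin_PSL2C_topology:
  "openin PSL2C_topology U \<longleftrightarrow> U \<subseteq> carrier PSL2C \<and>
     openin (top_of_set (carrier SL2C)) {A \<in> carrier SL2C. proj_PSL A \<in> U}"
proof -
  let ?S = "top_of_set (carrier SL2C)"
  have "istopology (\<lambda>U. U \<subseteq> carrier PSL2C \<and> openin ?S {A \<in> carrier SL2C. proj_PSL A \<in> U})"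
    unfolding istopology_def
  proof (intro conjI allI impI, goal_cases)
    case (2 U V)
    have "{A \<in> carrier SL2C. proj_PSL A \<in> U \<inter> V} =
        {A \<in> carrier SL2C. proj_PSL A \<in> U} \<inter> {A \<in> carrier SL2C. proj_PSL A \<in> V}" by blast
    with 2 show ?case by (metis (no_types, lifting) openin_Int)
  next
    case (4 K)
    have "{A \<in> carrier SL2C. proj_PSL A \<in> \<Union>K} =
        \<Union>((\<lambda>U. {A \<in> carrier SL2C. proj_PSL A \<in> U}) ` K)" by blast
    moreover have "openin ?S (\<Union>((\<lambda>U. {A \<in> carrier SL2C. proj_PSL A \<in> U}) ` K))"
      using 4 by (intro openin_Union) blast
    ultimately show ?case by simp
  qed blast+
  then show ?thesis unfolding PSL2C_topology_def by (simp add: topology_inverse')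
qed

lemma topspace_PSL2C_topology: "topspace PSL2C_topology = carrier PSL2C"
proof
  show "topspace PSL2C_topology \<subseteq> carrier PSL2C"
    unfolding topspace_def by (auto simp: openin_PSL2C_topology)
  have "{A \<in> carrier SL2C. proj_PSL A \<in> carrier PSL2C} = carrier SL2C"
    by (auto simp: carrier_PSL2C)
  then have "openin PSL2C_topology (carrier PSL2C)"
    by (simp add: openin_PSL2C_topology)
  then show "carrier PSL2C \<subseteq> topspace PSL2C_topology" by (rule openin_subset)
qed

lemma quotient_map_proj_PSL:
  "quotient_map (top_of_set (carrier SL2C)) PSL2C_topology proj_PSL"
  by (auto simp: quotient_map_def topspace_PSL2C_topology openin_PSL2C_topology carrier_PSL2C)

definition discrete_subset :: "mat2 set set \<Rightarrow> bool" where
  "discrete_subset \<Gamma> \<longleftrightarrow> subtopology PSL2C_topology \<Gamma> = discrete_topology \<Gamma>"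

section \<open>The action on hyperbolic 3-space and on its boundary sphere\<close>

text \<open>Upper half-space model, a point being (z, t) with t > 0.\<close>

definition H3 :: "(complex \<times> real) set" where
  "H3 = {(z, t). t > 0}"

text \<open>The Poincare extension: with q = z + tj a quaternion, the formula is
  (aq + b)(cq + d)^{-1}, written out for ad - bc = 1.\<close>

definition mat_H3 :: "mat2 \<Rightarrow> complex \<times> real \<Rightarrow> complex \<times> real" where
  "mat_H3 A = (\<lambda>(z, t).
     let a = A$1$1; b = A$1$2; c = A$2$1; d = A$2$2;
         D = (cmod (c * z + d))\<^sup>2 + (cmod c)\<^sup>2 * t\<^sup>2
     in (((a * z + b) * cnj (c * z + d) + a * cnj c * complex_of_real (t\<^sup>2)) / complex_of_real D,
         t / D))"

definition act_H3 :: "mat2 set \<Rightarrow> complex \<times> real \<Rightarrow> complex \<times> real" where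
  "act_H3 h = mat_H3 (lift h)"

text \<open>The Riemann sphere is \<open>complex option\<close>, with \<open>None\<close> as the point at infinity.\<close>

definition mat_sphere :: "mat2 \<Rightarrow> complex option \<Rightarrow> complex option" where
  "mat_sphere A w =
     (let a = A$1$1; b = A$1$2; c = A$2$1; d = A$2$2
      in case w of
           None \<Rightarrow> if c = 0 then None else Some (a / c)
         | Some z \<Rightarrow> if c * z + d = 0 then None else Some ((a * z + b) / (c * z + d)))"

definition act_sphere :: "mat2 set \<Rightarrow> complex option \<Rightarrow> complex option" where
  "act_sphere h = mat_sphere (lift h)"

lemma mat_H3_uminus: "mat_H3 (- A) = mat_H3 A"
proof -
  have "cmod (- x - y) = cmod (x + y)" for x y
    by (metis minus_add_distrib norm_minus_cancel uminus_add_conv_diff diff_conv_add_uminus)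
  then show ?thesis
    by (auto simp: mat_H3_def Let_def fun_eq_iff algebra_simps)
qed

lemma mat_sphere_uminus: "mat_sphere (- A) = mat_sphere A"
proof
  fix w
  have 1: "- x - y = 0 \<longleftrightarrow> x + y = (0::complex)" for x y
    by (metis minus_add_distrib diff_conv_add_uminus neg_equal_0_iff_equal)
  have 2: "(- x - y) / (- u - v) = (x + y) / (u + v :: complex)" for x y u v
  proof -
    have "- x - y = - (x + y)" "- u - v = - (u + v)" by simp_all
    then show ?thesis by (metis minus_divide_left minus_divide_right add.inverse_inverse)
  qed
  show "mat_sphere (- A) w = mat_sphere A w"
    by (cases w) (auto simp: mat_sphere_def Let_def 1 2 neg_eq_iff_add_eq_0 add_eq_0_iff)
qed

lemma act_lift_indep:
  assumes "h \<in> carrier PSL2C" "A \<in> h"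
  shows "act_H3 h = mat_H3 A" "act_sphere h = mat_sphere A"
  using lift_cases[OF assms]
  by (auto simp: act_H3_def act_sphere_def mat_H3_uminus mat_sphere_uminus)

text \<open>The hyperbolic planes of the upper half-space: hemispheres centred on the boundary
  and half-planes orthogonal to it.\<close>

definition hyperbolic_plane :: "(complex \<times> real) set \<Rightarrow> bool" where
  "hyperbolic_plane P \<longleftrightarrow>
     (\<exists>c r. r > 0 \<and> P = {(z, t) \<in> H3. (cmod (z - c))\<^sup>2 + t\<^sup>2 = r\<^sup>2}) \<or>
     (\<exists>w s. w \<noteq> 0 \<and> P = {(z, t) \<in> H3. Re (cnj w * z) = s})"

definition has_invariant_plane :: "mat2 set set \<Rightarrow> bool" where
  "has_invariant_plane \<Gamma> \<longleftrightarrow> (\<exists>P. hyperbolic_plane P \<and> (\<forall>h\<in>\<Gamma>. act_H3 h ` P = P))"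

text \<open>Elementary means having a finite orbit in the closure of hyperbolic 3-space.\<close>

definition elementary :: "mat2 set set \<Rightarrow> bool" where
  "elementary \<Gamma> \<longleftrightarrow>
     (\<exists>p\<in>H3. finite ((\<lambda>h. act_H3 h p) ` \<Gamma>)) \<or>
     (\<exists>w. finite ((\<lambda>h. act_sphere h w) ` \<Gamma>))"

definition RP_pair :: "mat2 set \<Rightarrow> mat2 set \<Rightarrow> bool" where
  "RP_pair f g \<longleftrightarrow> f \<in> carrier PSL2C \<and> g \<in> carrier PSL2C \<and>
     beta f \<in> \<real> \<and> beta g \<in> \<real> \<and> gamma f g \<in> \<real>"

section \<open>Groups given by generators and relations\<close>

text \<open>Words in the generators \<open>'a\<close>; the letter \<open>(x, True)\<close> is x and \<open>(x, False)\<close> is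
  the inverse of x.\<close>

type_synonym 'a gword = "('a \<times> bool) list"

definition gen :: "'a \<Rightarrow> 'a gword" where
  "gen x = [(x, True)]"

definition winv :: "'a gword \<Rightarrow> 'a gword" where
  "winv w = rev (map (\<lambda>(x, b). (x, \<not> b)) w)"

definition wpow :: "'a gword \<Rightarrow> int \<Rightarrow> 'a gword" where
  "wpow w k = (if k \<ge> 0 then concat (replicate (nat k) w)
               else concat (replicate (nat (- k)) (winv w)))"

text \<open>Equality of words in the group presented by the relators \<open>R\<close>: the least congruence of the
  monoid of words that contains the free cancellations and makes every relator trivial.\<close>

inductive pres_eq :: "'a gword set \<Rightarrow> 'a gword \<Rightarrow> 'a gword \<Rightarrow> bool" for R where
  pres_refl: "pres_eq R u u"
| pres_sym: "pres_eq R u v \<Longrightarrow> pres_eq R v u"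
| pres_trans: "pres_eq R u v \<Longrightarrow> pres_eq R v w \<Longrightarrow> pres_eq R u w"
| pres_append: "pres_eq R u u' \<Longrightarrow> pres_eq R v v' \<Longrightarrow> pres_eq R (u @ v) (u' @ v')"
| pres_cancel: "pres_eq R [(x, b), (x, \<not> b)] []"
| pres_relator: "r \<in> R \<Longrightarrow> pres_eq R r []"

definition pres_rel :: "'a gword set \<Rightarrow> ('a gword \<times> 'a gword) set" where
  "pres_rel R = {(u, v). pres_eq R u v}"

definition presented_group :: "'a gword set \<Rightarrow> 'a gword set monoid" where
  "presented_group R =
     \<lparr>carrier = UNIV // pres_rel R,
      mult = (\<lambda>U V. \<Union>u\<in>U. \<Union>v\<in>V. pres_rel R `` {u @ v}),
      one = pres_rel R `` {[]}\<rparr>"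

lemma equiv_pres_rel: "equiv UNIV (pres_rel R)"
  by (rule equivI)
    (auto simp: refl_on_def sym_def trans_def pres_rel_def intro: pres_eq.intros)

lemma presented_group_mult:
  "pres_rel R `` {u} \<otimes>\<^bsub>presented_group R\<^esub> pres_rel R `` {v} = pres_rel R `` {u @ v}"
proof -
  have "congruent2 (pres_rel R) (pres_rel R) (\<lambda>u v. pres_rel R `` {u @ v})"
  proof (rule congruent2I')
    fix u u' v v'
    assume "(u, u') \<in> pres_rel R" "(v, v') \<in> pres_rel R"
    then have "(u @ v, u' @ v') \<in> pres_rel R" by (simp add: pres_rel_def pres_append)
    then show "pres_rel R `` {u @ v} = pres_rel R `` {u' @ v'}"
      by (rule equiv_class_eq[OF equiv_pres_rel])
  qed
  then show ?thesis
    by (simp add: presented_group_def UN_equiv_class2[OF equiv_pres_rel equiv_pres_rel])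
qed

lemma pres_eq_winv: "pres_eq R (winv w @ w) []"
proof (induction w)
  case Nil
  then show ?case by (simp add: winv_def pres_refl)
next
  case (Cons a w)
  obtain x b where a: "a = (x, b)" by (cases a)
  have "pres_eq R ([(x, \<not> b), (x, b)] @ w) ([] @ w)"
    by (rule pres_append[OF _ pres_refl]) (use pres_cancel[of R x "\<not> b"] in simp)
  then have "pres_eq R (winv w @ ([(x, \<not> b), (x, b)] @ w)) (winv w @ ([] @ w))"
    by (rule pres_append[OF pres_refl])
  then show ?case using Cons by (auto simp: a winv_def intro: pres_trans)
qed

lemma group_presented_group: "group (presented_group R)"
proof (rule groupI)
  have c: "\<exists>u. U = pres_rel R `` {u}" if "U \<in> carrier (presented_group R)" for U
    using that by (auto simp: presented_group_def elim: quotientE)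
  have q: "pres_rel R `` {u} \<in> carrier (presented_group R)" for u
    by (simp add: presented_group_def quotientI)
  have one: "\<one>\<^bsub>presented_group R\<^esub> = pres_rel R `` {[]}" by (simp add: presented_group_def)
  show "\<one>\<^bsub>presented_group R\<^esub> \<in> carrier (presented_group R)" by (simp add: one q)
  fix U assume U: "U \<in> carrier (presented_group R)"
  then obtain u where u: "U = pres_rel R `` {u}" using c by blast
  show "\<one>\<^bsub>presented_group R\<^esub> \<otimes>\<^bsub>presented_group R\<^esub> U = U"
    by (simp add: u one presented_group_mult)
  have "pres_rel R `` {winv u @ u} = pres_rel R `` {[]}"
    by (rule equiv_class_eq[OF equiv_pres_rel]) (simp add: pres_rel_def pres_eq_winv)
  then show "\<exists>V\<in>carrier (presented_group R). V \<otimes>\<^bsub>presented_group R\<^esub> U = \<one>\<^bsub>presented_group R\<^esub>"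
    using q presented_group_mult u one by metis
  fix V assume "V \<in> carrier (presented_group R)"
  then obtain v where v: "V = pres_rel R `` {v}" using c by blast
  show "U \<otimes>\<^bsub>presented_group R\<^esub> V \<in> carrier (presented_group R)"
    by (simp add: u v presented_group_mult q)
  fix W assume "W \<in> carrier (presented_group R)"
  then obtain w where w: "W = pres_rel R `` {w}" using c by blast
  show "U \<otimes>\<^bsub>presented_group R\<^esub> V \<otimes>\<^bsub>presented_group R\<^esub> W =
      U \<otimes>\<^bsub>presented_group R\<^esub> (V \<otimes>\<^bsub>presented_group R\<^esub> W)"
    by (simp add: u v w presented_group_mult)
qed

section \<open>The groups GT and Tet\<close>

text \<open>\<open>Infty\<close> and \<open>BarInfty\<close> are the two formal symbols. A relation with either exponent is
  absent from the presentation of the abstract group; the exponent \<open>Infty\<close> only records that the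
  corresponding element of a Kleinian group is parabolic.\<close>

datatype exponent = Fin int | Infty | BarInfty

definition pow_rel :: "'a gword \<Rightarrow> exponent \<Rightarrow> 'a gword set" where
  "pow_rel w e = (case e of Fin k \<Rightarrow> {wpow w k} | Infty \<Rightarrow> {} | BarInfty \<Rightarrow> {})"

datatype GT_gen = GTf | GTg

definition GT :: "exponent \<Rightarrow> exponent \<Rightarrow> exponent \<Rightarrow> GT_gen gword set monoid" where
  "GT n m q =
     (let f = gen GTf; g = gen GTg
      in presented_group
           (pow_rel f n \<union> pow_rel g m \<union> pow_rel (f @ g @ winv f @ winv g) q))"

datatype Tet_gen = Tetx | Tety | Tetz

definition Tet :: "exponent \<Rightarrow> exponent \<Rightarrow> exponent \<Rightarrow> Tet_gen gword set monoid" where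
  "Tet n m q =
     (let x = gen Tetx; y = gen Tety; z = gen Tetz
      in presented_group
           ({wpow x 2, wpow y 2} \<union> pow_rel z n \<union> pow_rel (x @ winv y) m \<union>
            {wpow (y @ winv z) 2} \<union> pow_rel (z @ winv x) q))"

end

theory Submission
  imports Defs
begin

text \<open>The three parameters determine the pair \<open>(f, g)\<close> up to conjugation and up to replacing \<open>g\<close> by its
inverse. With \<open>T = tr f \<ge> 0\<close> for a suitable lift of \<open>f\<close> and \<open>t = sqrt (- \<gamma>) > 0\<close> the normal form is
\<open>f(z) = T/2 - 1/(z + T/2)\<close>, \<open>g(z) = z + it\<close> (\<open>generate_iso_normal_form\<close>). In this form
\<open>f = AS\<close> and \<open>g = CB\<close>, where \<open>A\<close>, \<open>B\<close>, \<open>C\<close> are the reflections in the lines \<open>Re z = 0\<close>,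
\<open>Im z = 0\<close>, \<open>Im z = t/2\<close> and \<open>S\<close> is the inversion in the circle \<open>|z + T/2| = 1\<close>. The mirrors \<open>A\<close>, \<open>B\<close>
are orthogonal, as are \<open>A\<close>, \<open>C\<close> and \<open>B\<close>, \<open>S\<close>; the mirrors \<open>B\<close>, \<open>C\<close> are parallel; and the remaining
two pairs are governed by \<open>T/2\<close> (for \<open>A\<close>, \<open>S\<close>) and \<open>t/2\<close> (for \<open>S\<close>, \<open>C\<close>): such a number is the
cosine of the angle if it is below 1, and the mirrors do not cross if it is at least 1. The
hypotheses on \<open>\<beta>(f)\<close> and \<open>\<gamma>(f, g)\<close> say that these angles are \<open>\<pi>/n\<close> and \<open>\<pi>/p\<close>. So the mirrors bound a
Coxeter polyhedron, and the group in question sits inside its reflection group.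

The relations hold because an element of trace \<open>\<plusminus>2 cos(\<pi>/m)\<close> has order dividing \<open>m\<close> in PSL(2,C)
(\<open>proj_PSL_power_trivial\<close>). That they suffice is the real content. Instead of
Poincare's polyhedron theorem the proof uses the argument of Tits for the faithfulness of the
geometric representation of a Coxeter group, in the form \<open>base_only_positive_point\<close>. The
abstract group \<open>P\<close> (\<open>GT\<close> or \<open>Tet\<close>) is extended by its
automorphisms that mimic conjugation by mirrors; on the extension the four mirrors act
by left multiplication as abstract involutions with the Coxeter relations, while their matrices
act on Hermitian forms, where each mirror is given by a linear form. The lemma of Tits says that
only the identity keeps the base point in the chamber where all four linear
forms are positive. An element of \<open>P\<close> that becomes trivial in PSL(2,C) fixes the base point, hence
is trivial (\<open>GT_iso\<close>, \<open>Tet_iso\<close>).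

The parity of \<open>p\<close> enters because \<open>[f, g] = A(SC)\<^sup>2A\<close>. If \<open>p = 2q\<close>, the commutator has order
\<open>q\<close> and the relation \<open>[f, g]\<^sup>q = 1\<close> is all that \<open>(SC)\<^sup>p = 1\<close> says about \<open>f\<close> and \<open>g\<close>. If \<open>p\<close> is odd, \<open>SC\<close> is itself
a power of \<open>(SC)\<^sup>2\<close>, so \<open>f\<close> and \<open>g\<close> generate all of \<open>AC\<close>, \<open>AB\<close>, \<open>AS\<close>, which are the
generators of \<open>Tet\<close> (\<open>Tet_iso_odd\<close>).\<close>

section \<open>Simple transitivity of reflection groups after Tits\<close>

fun alt_word :: "'i \<Rightarrow> 'i \<Rightarrow> nat \<Rightarrow> 'i list" where
  "alt_word i j 0 = []"
| "alt_word i j (Suc k) = i # alt_word j i k"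

lemma length_alt_word [simp]: "length (alt_word i j k) = k"
  by (induction k arbitrary: i j) auto

text \<open>The number \<open>c\<close> is minus the scalar product of the unit normals of two mirrors. For \<open>c \<ge> 1\<close> the mirrors do
not cross inside hyperbolic space and the product of the reflections has infinite order.\<close>

definition dihedral_pair :: "'x set \<Rightarrow> ('i \<Rightarrow> 'x \<Rightarrow> 'x) \<Rightarrow> real \<Rightarrow> 'i \<Rightarrow> 'i \<Rightarrow> bool" where
  "dihedral_pair X s c i j \<longleftrightarrow>
     c \<ge> 1 \<or> (\<exists>m::nat. m \<ge> 2 \<and> c = cos (pi / real m) \<and> (\<forall>x\<in>X. ((s i \<circ> s j) ^^ m) x = x))"

lemma funpow_closed:
  assumes "\<And>x. x \<in> X \<Longrightarrow> h x \<in> X" "x \<in> X"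
  shows "(h ^^ k) x \<in> X"
  using assms by (induction k) auto

lemma funpow_inverse:
  assumes "\<And>x. x \<in> X \<Longrightarrow> h x \<in> X" "\<And>x. x \<in> X \<Longrightarrow> h' x \<in> X"
    and "\<And>x. x \<in> X \<Longrightarrow> h' (h x) = x" "x \<in> X"
  shows "(h' ^^ k) ((h ^^ k) x) = x"
  using assms(4)
proof (induction k arbitrary: x)
  case (Suc k)
  have "(h' ^^ Suc k) ((h ^^ Suc k) x) = (h' ^^ k) (h' (h ((h ^^ k) x)))"
    by (simp add: funpow_swap1)
  also have "\<dots> = x"
    using Suc assms(3) funpow_closed[of X h, OF assms(1)] by simp
  finally show ?case .
qed simp

text \<open>An abstract stand-in for the chambers of a reflection group: \<open>X\<close> is an orbit with base point \<open>e\<close>, the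
involutions \<open>s i\<close> are left multiplications by the simple reflections, and \<open>\<xi> i x\<close> is the value of the
\<open>i\<close>-th linear form at the image of the base point under \<open>x\<close>. The
vector space enters only through the way these values change.\<close>

locale reflection_set =
  fixes X :: "'x set" and s :: "'i \<Rightarrow> 'x \<Rightarrow> 'x" and e :: 'x
    and \<xi> :: "'i \<Rightarrow> 'x \<Rightarrow> real" and c :: "'i \<Rightarrow> 'i \<Rightarrow> real"
  assumes base: "e \<in> X"
    and closed: "x \<in> X \<Longrightarrow> s i x \<in> X"
    and invol: "x \<in> X \<Longrightarrow> s i (s i x) = x"
    and reach: "x \<in> X \<Longrightarrow> \<exists>w. foldr s w e = x"
    and coord_same: "x \<in> X \<Longrightarrow> \<xi> i (s i x) = - \<xi> i x"
    and coord_other: "x \<in> X \<Longrightarrow> i \<noteq> j \<Longrightarrow> \<xi> j (s i x) = \<xi> j x + 2 * c i j * \<xi> i x"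
    and c_sym: "c i j = c j i"
    and pairs: "i \<noteq> j \<Longrightarrow> dihedral_pair X s (c i j) i j \<or> dihedral_pair X s (c i j) j i"
    and base_pos: "\<xi> i e > 0"
begin

lemma foldr_closed: "x \<in> X \<Longrightarrow> foldr s w x \<in> X"
  by (induction w) (auto intro: closed)

lemma foldr_alt_even: "foldr s (alt_word i j (2 * k)) x = ((s i \<circ> s j) ^^ k) x"
  by (induction k) auto

lemma foldr_alt_odd: "foldr s (alt_word i j (Suc (2 * k))) x = ((s i \<circ> s j) ^^ k) (s i x)"
  by (induction k) auto

lemma dihedral_pair_flip:
  assumes "dihedral_pair X s a j i"
  shows "dihedral_pair X s a i j"
proof -
  have "((s i \<circ> s j) ^^ m) x = x" if "\<forall>x\<in>X. ((s j \<circ> s i) ^^ m) x = x" "x \<in> X" for m x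
    using funpow_inverse[of X "s j \<circ> s i" "s i \<circ> s j" x m] that by (auto simp: closed invol)
  with assms show ?thesis unfolding dihedral_pair_def by blast
qed

lemma dihedral:
  assumes "i \<noteq> j"
  shows "dihedral_pair X s (c i j) i j"
  using pairs[OF assms] dihedral_pair_flip by blast

text \<open>In a dihedral group of order \<open>2m\<close> the two alternating words of length \<open>m\<close> are both the longest element.\<close>

lemma braid_relation:
  assumes r: "\<forall>x\<in>X. ((s i \<circ> s j) ^^ m) x = x" and x: "x \<in> X"
  shows "foldr s (alt_word i j m) x = foldr s (alt_word j i m) x"
proof -
  let ?r = "s i \<circ> s j" and ?r' = "s j \<circ> s i"
  have inv: "(?r' ^^ k) ((?r ^^ k) y) = y" if "y \<in> X" for y k
    using funpow_inverse[of X ?r ?r' y k] that by (auto simp: closed invol)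
  have cl: "(?r ^^ k) y \<in> X" if "y \<in> X" for y k
    using funpow_closed[of X ?r y k] that by (auto simp: closed)
  show ?thesis
  proof (cases "even m")
    case True
    then obtain k where k: "m = 2 * k" by blast
    have "(?r ^^ k) ((?r ^^ k) x) = x" using r x k by (simp add: funpow_add mult_2)
    then have "(?r ^^ k) x = (?r' ^^ k) x" using inv[of "(?r ^^ k) x" k] cl[OF x] by simp
    then show ?thesis using k by (simp add: foldr_alt_even)
  next
    case False
    then obtain k where k: "m = Suc (2 * k)" by (metis oddE Suc_eq_plus1)
    have "(?r ^^ m) (s j x) = (?r ^^ k) ((?r ^^ k) (s i x))"
      using x by (simp add: k funpow_add mult_2 funpow_swap1 invol)
    then have "(?r ^^ k) ((?r ^^ k) (s i x)) = s j x" using r closed[OF x, of j] by simp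
    then have "(?r ^^ k) (s i x) = (?r' ^^ k) (s j x)"
      using inv[of "(?r ^^ k) (s i x)" k] cl[OF closed[OF x]] by simp
    then show ?thesis by (simp only: k foldr_alt_odd)
  qed
qed

text \<open>The letter \<open>i\<close> is the one that would come next on the left. That \<open>\<xi> i\<close> stays positive is not preserved by
itself; the inequality \<open>\<xi> i + \<xi> j \<ge> 0\<close> is what makes the induction work when \<open>c \<ge> 1\<close>.\<close>

lemma coord_alt_infinite:
  assumes c: "c i j \<ge> 1" and ij: "i \<noteq> j" and y: "y \<in> X" and pos: "\<xi> i y > 0" "\<xi> j y > 0"
  shows "\<xi> i (foldr s (alt_word j i k) y) > 0 \<and>
    \<xi> i (foldr s (alt_word j i k) y) + \<xi> j (foldr s (alt_word j i k) y) \<ge> 0"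
  using c ij pos
proof (induction k arbitrary: i j)
  case (Suc k)
  let ?v = "foldr s (alt_word i j k) y"
  have v: "?v \<in> X" using foldr_closed[OF y] .
  have IH: "\<xi> j ?v > 0" "\<xi> j ?v + \<xi> i ?v \<ge> 0"
    using Suc.IH[of j i] Suc.prems c_sym by auto
  have "1 * \<xi> j ?v \<le> c j i * \<xi> j ?v"
    using Suc.prems IH c_sym by (intro mult_right_mono) auto
  moreover have "\<xi> i (s j ?v) = \<xi> i ?v + 2 * (c j i * \<xi> j ?v)"
    using coord_other[OF v, of j i] Suc.prems by simp
  ultimately show ?case
    using coord_same[OF v, of j] IH
    by (intro conjI; simp only: alt_word.simps foldr.simps o_apply; linarith)
qed simp

text \<open>For \<open>c = cos \<theta>\<close> the coordinates along an alternating word obey the recurrence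
\<open>u (k + 1) = 2 cos \<theta> u k - u (k - 1)\<close>, solved by \<open>sin (k\<theta>) / sin \<theta>\<close>. The weights \<open>a\<close> and \<open>b\<close> are the two
coordinates of \<open>y\<close>; which is which depends on the parity of \<open>k\<close>, and only their sign matters.\<close>

lemma coord_alt_finite:
  assumes c: "c i j = cos \<theta>" and ij: "i \<noteq> j" and y: "y \<in> X" and pos: "\<xi> i y > 0" "\<xi> j y > 0"
  shows "\<exists>a b. a > 0 \<and> b > 0 \<and>
    sin \<theta> * \<xi> i (foldr s (alt_word j i k) y) = sin (real k * \<theta>) * b + sin (real (Suc k) * \<theta>) * a \<and>
    sin \<theta> * \<xi> j (foldr s (alt_word j i k) y) =
      - (sin (real k * \<theta> - \<theta>) * b + sin (real k * \<theta>) * a)"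
  using c ij pos
proof (induction k arbitrary: i j)
  case 0
  then show ?case by (intro exI[of _ "\<xi> i y"] exI[of _ "\<xi> j y"]) simp
next
  case (Suc k)
  let ?v = "foldr s (alt_word i j k) y"
  have v: "?v \<in> X" using foldr_closed[OF y] .
  obtain a b where ab: "a > 0" "b > 0"
    "sin \<theta> * \<xi> j ?v = sin (real k * \<theta>) * b + sin (real (Suc k) * \<theta>) * a"
    "sin \<theta> * \<xi> i ?v = - (sin (real k * \<theta> - \<theta>) * b + sin (real k * \<theta>) * a)"
    using Suc.IH[of j i] Suc.prems c_sym by metis
  have cheb: "2 * cos \<theta> * sin t = sin (t + \<theta>) + sin (t - \<theta>)" for t
    by (simp add: sin_add sin_diff)
  have "sin \<theta> * \<xi> i (s j ?v) = sin \<theta> * \<xi> i ?v + 2 * cos \<theta> * (sin \<theta> * \<xi> j ?v)"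
    using coord_other[OF v, of j i] Suc.prems c_sym[of i j] by (simp add: algebra_simps)
  also have "\<dots> = - (sin (real k * \<theta> - \<theta>) * b + sin (real k * \<theta>) * a) +
      (2 * cos \<theta> * sin (real k * \<theta>)) * b + (2 * cos \<theta> * sin (real (Suc k) * \<theta>)) * a"
    unfolding ab by (simp add: algebra_simps)
  also have "\<dots> = sin (real (Suc k) * \<theta>) * b + sin (real (Suc (Suc k)) * \<theta>) * a"
    unfolding cheb by (simp add: algebra_simps)
  finally show ?case
    using ab(1-3) coord_same[OF v, of j]
    by (intro exI[of _ a] exI[of _ b]) (auto simp: algebra_simps)
qed

text \<open>A word in two involutions reduces to an alternating one by cancelling equal neighbours. If a finite
order \<open>m\<close> is given (\<open>M = Some m\<close>), the braid relation lets a word of length \<open>m\<close> begin with either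
letter, so that prolonging it also ends in a cancellation.\<close>

lemma dihedral_normal_form:
  assumes ij: "i \<noteq> j" and y: "y \<in> X" and u: "set u \<subseteq> {i, j}"
    and m: "\<And>m. M = Some m \<Longrightarrow> m \<ge> 1 \<and> (\<forall>x\<in>X. ((s i \<circ> s j) ^^ m) x = x)"
  shows "\<exists>k a b. k \<le> length u \<and> (\<forall>m. M = Some m \<longrightarrow> k \<le> m) \<and>
    (a = i \<and> b = j \<or> a = j \<and> b = i) \<and> foldr s u y = foldr s (alt_word a b k) y"
  using u
proof (induction u)
  case Nil
  show ?case by (rule exI[of _ 0]) auto
next
  case (Cons d u)
  then obtain k a b where k: "k \<le> length u" "\<forall>m. M = Some m \<longrightarrow> k \<le> m"
    and ab: "a = i \<and> b = j \<or> a = j \<and> b = i" and eq: "foldr s u y = foldr s (alt_word a b k) y"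
    by auto
  have cancel: ?case if "foldr s u y = foldr s (alt_word d d' k) y" "k \<noteq> 0" "{d, d'} = {i, j}" for d'
  proof -
    obtain k' where k': "k = Suc k'" using \<open>k \<noteq> 0\<close> by (cases k) auto
    have "foldr s (d # u) y = foldr s (alt_word d' d k') y"
      using that k' invol[OF foldr_closed[OF y]] by simp
    then show ?thesis
      using k k' that(3) by (intro exI[of _ k'] exI[of _ d'] exI[of _ d]) (auto simp: doubleton_eq_iff)
  qed
  have "d = i \<or> d = j" using Cons.prems by auto
  consider "k = 0" | "d = a" "k \<noteq> 0" | "d = b" "k \<noteq> 0" using ab \<open>d = i \<or> d = j\<close> by blast
  then show ?case
  proof cases
    case 1
    then have "foldr s (d # u) y = foldr s (alt_word d (if d = i then j else i) 1) y" using eq by simp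
    moreover have "\<forall>m. M = Some m \<longrightarrow> 1 \<le> m" using m by auto
    ultimately show ?thesis using \<open>d = i \<or> d = j\<close>
      by (intro exI[of _ 1] exI[of _ d] exI[of _ "if d = i then j else i"]) auto
  next
    case 2
    then show ?thesis using cancel[of b] eq ab by auto
  next
    case 3
    show ?thesis
    proof (cases "M = Some k")
      case True
      have "foldr s (alt_word a b k) y = foldr s (alt_word b a k) y"
        using braid_relation[where i = i and j = j and m = k and x = y] m[OF True] ab y by auto
      then show ?thesis using cancel[of a] eq ab 3 by auto
    next
      case False
      then have "\<forall>m. M = Some m \<longrightarrow> Suc k \<le> m" using k(2) by (metis Suc_leI le_neq_implies_less)
      then show ?thesis using 3 eq ab k(1)
        by (intro exI[of _ "Suc k"] exI[of _ b] exI[of _ a]) auto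
    qed
  qed
qed

text \<open>Tits' theorem for a rank two system: where \<open>\<xi> i\<close> is not positive, the reflection \<open>s i\<close> shortens the
word. Indeed short alternating words that begin with \<open>j\<close> leave \<open>\<xi> i\<close> positive by the preceding formulas,
so the reduced word can be taken to begin with \<open>i\<close>.\<close>

lemma dihedral_descent:
  assumes ij: "i \<noteq> j" and y: "y \<in> X" and u: "set u \<subseteq> {i, j}" and pos: "\<xi> i y > 0" "\<xi> j y > 0"
    and neg: "\<not> \<xi> i (foldr s u y) > 0"
  shows "\<exists>u'. length u' < length u \<and> s i (foldr s u y) = foldr s u' y"
proof -
  have shorter: ?thesis if "foldr s u y = foldr s (alt_word i j k) y" "k \<noteq> 0" "k \<le> length u" for k
  proof -
    obtain k' where k': "k = Suc k'" using \<open>k \<noteq> 0\<close> by (cases k) auto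
    then have "s i (foldr s u y) = foldr s (alt_word j i k') y"
      using that invol[OF foldr_closed[OF y]] by simp
    then show ?thesis using k' that by (intro exI[of _ "alt_word j i k'"]) auto
  qed
  consider "c i j \<ge> 1" | m where "m \<ge> 2" "c i j = cos (pi / real m)"
      "\<forall>x\<in>X. ((s i \<circ> s j) ^^ m) x = x"
    using dihedral[OF ij] unfolding dihedral_pair_def by blast
  then show ?thesis
  proof cases
    case 1
    obtain k a b where k: "k \<le> length u" "a = i \<and> b = j \<or> a = j \<and> b = i"
      "foldr s u y = foldr s (alt_word a b k) y"
      using dihedral_normal_form[OF ij y u, of None] by auto
    have "\<not> (a = j \<and> b = i)" "k \<noteq> 0"
      using coord_alt_infinite[OF 1 ij y pos, of k] neg k pos by (auto intro: ccontr)
    then show ?thesis using shorter[of k] k by auto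
  next
    case 2
    obtain k a b where k: "k \<le> length u" "k \<le> m" "a = i \<and> b = j \<or> a = j \<and> b = i"
      "foldr s u y = foldr s (alt_word a b k) y"
      using dihedral_normal_form[OF ij y u, of "Some m"] 2 by auto
    define \<theta> where "\<theta> = pi / real m"
    have \<theta>: "0 < \<theta>" "\<theta> < pi" "real m * \<theta> = pi" using 2(1) by (auto simp: \<theta>_def field_simps)
    have sin\<theta>: "sin \<theta> > 0" using \<theta> sin_gt_zero by blast
    have short: "\<xi> i (foldr s (alt_word j i k) y) > 0" if "k < m"
    proof -
      obtain a b where ab: "a > 0" "b > 0"
        "sin \<theta> * \<xi> i (foldr s (alt_word j i k) y) = sin (real k * \<theta>) * b + sin (real (Suc k) * \<theta>) * a"
        using coord_alt_finite[of i j \<theta> y k] 2 ij y pos \<theta>_def by auto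
      have nonneg: "sin (real l * \<theta>) \<ge> 0" if "l \<le> m" for l
        using that \<theta> mult_right_mono[of "real l" "real m" \<theta>] by (intro sin_ge_zero) auto
      have "sin (real k * \<theta>) * b + sin (real (Suc k) * \<theta>) * a > 0"
      proof (cases "k = 0")
        case True
        then show ?thesis using ab sin\<theta> by simp
      next
        case False
        have "real k * \<theta> < pi" using that \<theta> mult_strict_right_mono[of "real k" "real m" \<theta>] by simp
        then have "sin (real k * \<theta>) > 0" using False \<theta> by (intro sin_gt_zero) auto
        then show ?thesis using ab nonneg[of "Suc k"] that
          by (intro add_pos_nonneg mult_pos_pos mult_nonneg_nonneg) auto
      qed
      then show ?thesis using ab(3) sin\<theta> by (metis zero_less_mult_pos)
    qed
    \<comment> \<open>At full length the word may be read as beginning with either letter.\<close>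
    show ?thesis
    proof (cases "k = m")
      case True
      then have "foldr s u y = foldr s (alt_word i j k) y"
        using braid_relation[OF 2(3) y] k by auto
      then show ?thesis using shorter[of k] k True 2(1) by auto
    next
      case False
      then have "\<not> (a = j \<and> b = i)" "k \<noteq> 0"
        using short neg k pos by (auto intro: ccontr)
      then show ?thesis using shorter[of k] k by auto
    qed
  qed
qed

definition len :: "'x \<Rightarrow> nat" where
  "len x = (LEAST n. \<exists>w. length w = n \<and> foldr s w e = x)"

lemma len_witness:
  assumes "x \<in> X"
  obtains w where "length w = len x" "foldr s w e = x"
proof -
  have "\<exists>w. length w = len x \<and> foldr s w e = x"
    unfolding len_def by (rule LeastI_ex) (use reach[OF assms] in blast)
  then show ?thesis using that by blast
qed

lemma len_foldr_le:
  assumes "y \<in> X"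
  shows "len (foldr s u y) \<le> length u + len y"
proof -
  obtain w where w: "length w = len y" "foldr s w e = y" using len_witness[OF assms] .
  have "length (u @ w) = length u + len y \<and> foldr s (u @ w) e = foldr s u y" using w by simp
  then show ?thesis unfolding len_def[of "foldr s u y"] by (intro Least_le) blast
qed

lemma len_pos_decompose:
  assumes "x \<in> X" "len x \<noteq> 0"
  obtains i x' where "x' \<in> X" "x = s i x'" "Suc (len x') = len x"
proof -
  obtain w where w: "length w = len x" "foldr s w e = x" using len_witness[OF assms(1)] .
  then obtain i w' where iw: "w = i # w'" using assms(2) by (cases w) auto
  let ?x' = "foldr s w' e"
  have x': "?x' \<in> X" using foldr_closed base by blast
  have "len ?x' \<le> length w'"
    unfolding len_def by (rule Least_le) blast
  moreover have "len x \<le> Suc (len ?x')" using len_foldr_le[OF x', of "[i]"] w iw by simp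
  ultimately have "Suc (len ?x') = len x" using w iw by simp
  then show ?thesis using that[OF x', of i] w iw by simp
qed

lemma len_0: "x \<in> X \<Longrightarrow> len x = 0 \<Longrightarrow> x = e"
  using len_witness by (metis length_0_conv foldr.simps(1) id_apply)

text \<open>The induction of Tits. Descent at \<open>x = s j x'\<close> follows from splitting off from \<open>x'\<close> the part that lies in the
dihedral group of \<open>i\<close> and \<open>j\<close>, for which \<open>dihedral_descent\<close> applies; conversely the splitting for \<open>x\<close>
is obtained by descending along \<open>i\<close> and \<open>j\<close> as long as one of the two coordinates is not positive. Each
statement needs the other at smaller length, so both are proved together.\<close>

lemma descent_and_dihedral_factor:
  assumes "x \<in> X"
  shows "(\<forall>i. \<not> \<xi> i x > 0 \<longrightarrow> len (s i x) < len x) \<and>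
    (\<forall>i j. i \<noteq> j \<longrightarrow> (\<exists>u y. set u \<subseteq> {i, j} \<and> y \<in> X \<and> x = foldr s u y \<and> \<xi> i y > 0 \<and> \<xi> j y > 0 \<and>
       length u + len y \<le> len x))"
  using assms
proof (induction "len x" arbitrary: x rule: less_induct)
  case less
  have descent: "len (s i x) < len x" if neg: "\<not> \<xi> i x > 0" for i
  proof -
    have "len x \<noteq> 0" using len_0[OF less.prems] neg base_pos by auto
    then obtain j x' where x': "x' \<in> X" "x = s j x'" "Suc (len x') = len x"
      using len_pos_decompose[OF less.prems] by blast
    show ?thesis
    proof (cases "j = i")
      case True
      then show ?thesis using x' invol by auto
    next
      case False
      then obtain u y where uy: "set u \<subseteq> {i, j}" "y \<in> X" "x' = foldr s u y" "\<xi> i y > 0" "\<xi> j y > 0"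
        "length u + len y \<le> len x'"
        using less.hyps[of x'] x' by (metis lessI)
      have "\<exists>u'. length u' < length (j # u) \<and> s i (foldr s (j # u) y) = foldr s u' y"
        using uy neg x' False by (intro dihedral_descent[of i j]) auto
      then obtain u' where "length u' < Suc (length u)" "s i (s j x') = foldr s u' y"
        using uy(3) by auto
      then have "length u' \<le> length u" "s i x = foldr s u' y" using x'(2) by auto
      then show ?thesis using len_foldr_le[OF uy(2), of u'] uy(6) x'(3) by simp
    qed
  qed
  have "\<exists>u y. set u \<subseteq> {i, j} \<and> y \<in> X \<and> x = foldr s u y \<and> \<xi> i y > 0 \<and> \<xi> j y > 0 \<and>
       length u + len y \<le> len x" if ij: "i \<noteq> j" for i j
  proof (cases "\<xi> i x > 0 \<and> \<xi> j x > 0")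
    case True
    then show ?thesis using less.prems by (intro exI[of _ "[]"] exI[of _ x]) auto
  next
    case False
    then obtain d where d: "d \<in> {i, j}" "\<not> \<xi> d x > 0" by blast
    have "len (s d x) < len x" using descent d by blast
    moreover from this obtain u y where uy: "set u \<subseteq> {i, j}" "y \<in> X" "s d x = foldr s u y"
      "\<xi> i y > 0" "\<xi> j y > 0" "length u + len y \<le> len (s d x)"
      using less.hyps[of "s d x"] closed[OF less.prems] ij by metis
    moreover have "x = foldr s (d # u) y" using uy(3) invol[OF less.prems, of d] by simp
    ultimately show ?thesis using d by (intro exI[of _ "d # u"] exI[of _ y]) auto
  qed
  with descent show ?case by blast
qed

text \<open>If \<open>x \<noteq> e\<close>, write \<open>x = s i x'\<close> with \<open>x'\<close> shorter. Then \<open>\<xi> i x'\<close> is negative, so \<open>s i\<close> would have to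
shorten \<open>x'\<close>, although it leads back to the longer \<open>x\<close>.\<close>

theorem base_only_positive_point:
  assumes x: "x \<in> X" and pos: "\<And>i. \<xi> i x > 0"
  shows "x = e"
proof (rule ccontr)
  assume "x \<noteq> e"
  then obtain i x' where x': "x' \<in> X" "x = s i x'" "Suc (len x') = len x"
    using len_pos_decompose[OF x] len_0[OF x] by blast
  have "\<not> \<xi> i x' > 0" using coord_same[OF x'(1), of i] pos[of i] x' by simp
  then have "len x < len x'" using descent_and_dihedral_factor[OF x'(1)] x'(2) by blast
  with x'(3) show False by simp
qed

end

section \<open>Homomorphisms out of a presented group\<close>

definition eval_word :: "('b, 'c) monoid_scheme \<Rightarrow> ('a \<Rightarrow> 'b) \<Rightarrow> 'a gword \<Rightarrow> 'b" where
  "eval_word H h w =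
     foldr (\<lambda>(x, b) y. (if b then h x else inv\<^bsub>H\<^esub> h x) \<otimes>\<^bsub>H\<^esub> y) w \<one>\<^bsub>H\<^esub>"

locale group_assignment = group H for H (structure) +
  fixes h :: "'a \<Rightarrow> 'b"
  assumes assign_closed [simp]: "h x \<in> carrier H"
begin

lemma eval_Nil [simp]: "eval_word H h [] = \<one>"
  by (simp add: eval_word_def)

lemma eval_Cons: "eval_word H h ((x, b) # w) = (if b then h x else inv h x) \<otimes> eval_word H h w"
  by (simp add: eval_word_def)

lemma eval_closed [simp]: "eval_word H h w \<in> carrier H"
  by (induction w) (auto simp: eval_Cons)

lemma eval_append [simp]: "eval_word H h (u @ v) = eval_word H h u \<otimes> eval_word H h v"
  by (induction u) (auto simp: eval_Cons m_assoc)

lemma eval_gen [simp]: "eval_word H h (gen x) = h x"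
  by (simp add: gen_def eval_Cons)

lemma eval_winv [simp]: "eval_word H h (winv w) = inv (eval_word H h w)"
proof (induction w)
  case (Cons a w)
  obtain x b where a: "a = (x, b)" by (cases a)
  have "eval_word H h (winv (a # w)) = eval_word H h (winv w) \<otimes> eval_word H h [(x, \<not> b)]"
    by (simp add: a winv_def)
  then show ?case using Cons by (simp add: a eval_Cons inv_mult_group)
qed (simp add: winv_def)

lemma eval_wpow [simp]: "eval_word H h (wpow w k) = eval_word H h w [^] k"
proof -
  have r: "eval_word H h (concat (replicate n u)) = eval_word H h u [^] n" for u and n :: nat
  proof (induction n)
    case (Suc n)
    then show ?case using nat_pow_Suc2[of "eval_word H h u" n] by (simp del: nat_pow_Suc)
  qed simp
  show ?thesis
  proof (cases "k \<ge> 0")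
    case True
    then show ?thesis by (simp add: wpow_def r flip: int_pow_int)
  next
    case False
    then obtain n where k: "k = - int n" by (metis linear nonneg_int_cases minus_equation_iff neg_0_le_iff_le)
    have "eval_word H h (wpow w k) = inv eval_word H h w [^] n"
      using False by (simp add: wpow_def r k)
    also have "\<dots> = eval_word H h w [^] k"
      unfolding k by (simp only: int_pow_neg_int nat_pow_inv eval_closed)
    finally show ?thesis .
  qed
qed

lemma eval_pres_eq:
  assumes "\<And>r. r \<in> R \<Longrightarrow> eval_word H h r = \<one>" "pres_eq R u v"
  shows "eval_word H h u = eval_word H h v"
  using assms(2)
  by induction (auto simp: assms(1) eval_Cons)

end

definition word_class :: "'a gword set \<Rightarrow> 'a gword \<Rightarrow> 'a gword set" where
  "word_class R w = pres_rel R `` {w}"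

definition pres_gen :: "'a gword set \<Rightarrow> 'a \<Rightarrow> 'a gword set" where
  "pres_gen R x = word_class R (gen x)"

lemma word_class_closed [simp]: "word_class R w \<in> carrier (presented_group R)"
  by (simp add: word_class_def presented_group_def quotientI)

lemma word_class_append: "word_class R u \<otimes>\<^bsub>presented_group R\<^esub> word_class R v = word_class R (u @ v)"
  by (simp add: word_class_def presented_group_mult)

lemma word_class_Nil: "word_class R [] = \<one>\<^bsub>presented_group R\<^esub>"
  by (simp add: word_class_def presented_group_def)

lemma word_class_eq: "pres_eq R u v \<Longrightarrow> word_class R u = word_class R v"
  unfolding word_class_def by (rule equiv_class_eq[OF equiv_pres_rel]) (simp add: pres_rel_def)

lemma word_class_cases:
  assumes "p \<in> carrier (presented_group R)"
  obtains w where "p = word_class R w"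
  using assms by (auto simp: presented_group_def word_class_def elim: quotientE)

lemma pres_gen_closed [simp]: "pres_gen R x \<in> carrier (presented_group R)"
  by (simp add: pres_gen_def)

lemma group_assignment_pres_gen: "group_assignment (presented_group R) (pres_gen R)"
  by (intro group_assignment.intro group_presented_group group_assignment_axioms.intro) simp

lemma word_class_winv: "word_class R (winv w) = inv\<^bsub>presented_group R\<^esub> word_class R w"
proof -
  interpret group "presented_group R" by (rule group_presented_group)
  show ?thesis
    by (rule inv_equality[symmetric])
      (auto simp: word_class_append word_class_eq[OF pres_eq_winv] word_class_Nil)
qed

lemma eval_pres_gen: "eval_word (presented_group R) (pres_gen R) w = word_class R w"
proof -
  interpret group_assignment "presented_group R" "pres_gen R" by (rule group_assignment_pres_gen)
  show ?thesis
  proof (induction w)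
    case Nil
    show ?case by (simp add: word_class_Nil)
  next
    case (Cons a w)
    obtain x b where a: "a = (x, b)" by (cases a)
    have "word_class R [(x, False)] = inv\<^bsub>presented_group R\<^esub> pres_gen R x"
      using word_class_winv[of R "gen x"] by (simp add: gen_def pres_gen_def winv_def)
    then have "(if b then pres_gen R x else inv\<^bsub>presented_group R\<^esub> pres_gen R x) = word_class R [a]"
      by (cases b) (auto simp: a pres_gen_def gen_def)
    then show ?case using Cons by (simp add: a eval_Cons word_class_append)
  qed
qed

lemma relator_trivial:
  assumes "r \<in> R"
  shows "eval_word (presented_group R) (pres_gen R) r = \<one>\<^bsub>presented_group R\<^esub>"
  using word_class_eq[OF pres_relator[OF assms]] by (simp add: eval_pres_gen word_class_Nil)

text \<open>Words are built from the left, so it suffices to multiply by one generator or inverse generator at a time.\<close>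

lemma presented_group_induct [consumes 1, case_names one mult inv]:
  assumes "p \<in> carrier (presented_group R)"
    and "Q \<one>\<^bsub>presented_group R\<^esub>"
    and "\<And>x p. p \<in> carrier (presented_group R) \<Longrightarrow> Q p \<Longrightarrow> Q (pres_gen R x \<otimes>\<^bsub>presented_group R\<^esub> p)"
    and "\<And>x p. p \<in> carrier (presented_group R) \<Longrightarrow> Q p \<Longrightarrow>
      Q (inv\<^bsub>presented_group R\<^esub> pres_gen R x \<otimes>\<^bsub>presented_group R\<^esub> p)"
  shows "Q p"
proof -
  interpret group_assignment "presented_group R" "pres_gen R" by (rule group_assignment_pres_gen)
  have "Q (eval_word (presented_group R) (pres_gen R) w)" for w
  proof (induction w)
    case (Cons a w)
    then show ?case using assms(3,4) by (cases a) (auto simp: eval_Cons)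
  qed (simp add: assms(2))
  then show ?thesis using word_class_cases[OF assms(1)] by (metis eval_pres_gen)
qed

text \<open>The universal property: an assignment of the generators that respects the relators extends to the
presented group.\<close>

locale presented_hom = group_assignment H h for H (structure) and h :: "'a \<Rightarrow> 'b" +
  fixes R :: "'a gword set"
  assumes relators: "r \<in> R \<Longrightarrow> eval_word H h r = \<one>"
begin

definition induced :: "'a gword set \<Rightarrow> 'b" where
  "induced U = eval_word H h (SOME w. w \<in> U)"

lemma induced_class: "induced (word_class R w) = eval_word H h w"
proof -
  have "w \<in> word_class R w" by (simp add: word_class_def pres_rel_def pres_refl)
  then have "(SOME u. u \<in> word_class R w) \<in> word_class R w" by (rule someI)
  then have "pres_eq R w (SOME u. u \<in> word_class R w)" by (simp add: word_class_def pres_rel_def)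
  then show ?thesis
    unfolding induced_def using eval_pres_eq[OF relators] by metis
qed

lemma induced_gen [simp]: "induced (pres_gen R x) = h x"
  by (simp add: pres_gen_def induced_class)

lemma induced_hom: "induced \<in> hom (presented_group R) H"
proof (rule homI)
  fix p q assume "p \<in> carrier (presented_group R)" "q \<in> carrier (presented_group R)"
  then show "induced (p \<otimes>\<^bsub>presented_group R\<^esub> q) = induced p \<otimes> induced q"
    by (elim word_class_cases) (simp add: word_class_append induced_class)
qed (auto simp: induced_class elim: word_class_cases)

lemma group_hom_induced: "group_hom (presented_group R) H induced"
  by (intro group_hom.intro group_hom_axioms.intro group_presented_group induced_hom)
     (rule is_group)

sublocale ind: group_hom "presented_group R" H induced by (rule group_hom_induced)

lemma induced_image: "induced ` carrier (presented_group R) = generate H (range h)"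
proof
  show "induced ` carrier (presented_group R) \<subseteq> generate H (range h)"
  proof
    fix y assume "y \<in> induced ` carrier (presented_group R)"
    then obtain p where p: "p \<in> carrier (presented_group R)" "y = induced p" by blast
    from p(1) have "induced p \<in> generate H (range h)"
    proof (induction rule: presented_group_induct)
      case one
      then show ?case by (simp add: generate.one)
    next
      case (mult x p)
      then show ?case using generate.eng[OF generate.incl[of "h x" "range h" H] mult(2)] by simp
    next
      case (inv x p)
      then show ?case using generate.eng[OF generate.inv[of "h x" "range h" H] inv(2)] by simp
    qed
    then show "y \<in> generate H (range h)" by (simp add: p)
  qed
  have "h x \<in> induced ` carrier (presented_group R)" for x
    by (metis imageI induced_gen pres_gen_closed)
  then show "generate H (range h) \<subseteq> induced ` carrier (presented_group R)"
    by (intro generate_subgroup_incl ind.img_is_subgroup) auto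
qed

text \<open>An element with trivial image in PSL(2,C) does not move the base point, whose coordinates are positive.\<close>

lemma faithful_imp_iso:
  assumes "\<And>p. p \<in> carrier (presented_group R) \<Longrightarrow> induced p = \<one> \<Longrightarrow> p = \<one>\<^bsub>presented_group R\<^esub>"
  shows "H\<lparr>carrier := generate H (range h)\<rparr> \<cong> presented_group R"
proof -
  have "inj_on induced (carrier (presented_group R))"
    using assms by (intro ind.inj_on_one_iff[THEN iffD2]) auto
  then have "induced \<in> iso (presented_group R) (H\<lparr>carrier := generate H (range h)\<rparr>)"
    using induced_image ind.homh by (simp add: iso_def hom_def bij_betw_def) blast
  then have "presented_group R \<cong> H\<lparr>carrier := generate H (range h)\<rparr>" by (rule is_isoI)
  then show ?thesis by (rule group.iso_sym[OF group_presented_group])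
qed

end

section \<open>Action of PSL(2,C) on Hermitian forms and the four mirrors\<close>

definition mk2 :: "complex \<Rightarrow> complex \<Rightarrow> complex \<Rightarrow> complex \<Rightarrow> mat2" where
  "mk2 a b c d = vector [vector [a, b], vector [c, d]]"

lemma mk2_entry [simp]:
  "mk2 a b c d $ 1 $ 1 = a" "mk2 a b c d $ 1 $ 2 = b" "mk2 a b c d $ 2 $ 1 = c" "mk2 a b c d $ 2 $ 2 = d"
  by (simp_all add: mk2_def)

lemma mat2_eq_iff:
  "A = (B :: mat2) \<longleftrightarrow> A$1$1 = B$1$1 \<and> A$1$2 = B$1$2 \<and> A$2$1 = B$2$1 \<and> A$2$2 = B$2$2"
  by (auto simp: vec_eq_iff forall_2)

lemma mk2_eq_iff [simp]: "mk2 a b c d = mk2 a' b' c' d' \<longleftrightarrow> a = a' \<and> b = b' \<and> c = c' \<and> d = d'"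
  by (simp add: mat2_eq_iff)

lemma mk2_cases:
  obtains a b c d where "A = mk2 a b c d"
  using that[of "A$1$1" "A$1$2" "A$2$1" "A$2$2"] by (simp add: mat2_eq_iff)

lemma mk2_mult [simp]:
  "mk2 a b c d ** mk2 a' b' c' d' = mk2 (a * a' + b * c') (a * b' + b * d') (c * a' + d * c') (c * b' + d * d')"
  by (simp add: mat2_eq_iff matrix_matrix_mult_def sum_2)

lemma det_mk2 [simp]: "det (mk2 a b c d) = a * d - b * c"
  by (simp add: det_2)

lemma trace_mk2 [simp]: "trace (mk2 a b c d) = a + d"
  by (simp add: trace_def sum_2)

lemma uminus_mk2 [simp]: "- mk2 a b c d = mk2 (- a) (- b) (- c) (- d)"
  by (simp add: mat2_eq_iff)

lemma one_mk2: "mat 1 = mk2 1 0 0 1"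
  by (simp add: mat2_eq_iff mat_def)

lemma SL2C_simps [simp]:
  "A \<otimes>\<^bsub>SL2C\<^esub> B = A ** B" "\<one>\<^bsub>SL2C\<^esub> = mat 1" "A \<in> carrier SL2C \<longleftrightarrow> det A = 1"
  by (simp_all add: SL2C_def)

lemma inv_SL2C_mk2:
  assumes "a * d - b * c = 1"
  shows "inv\<^bsub>SL2C\<^esub> (mk2 a b c d) = mk2 d (- b) (- c) a"
  using group.inv_equality[OF group_SL2C, of "mk2 d (- b) (- c) a" "mk2 a b c d"] assms
  by (simp add: one_mk2 algebra_simps)

lemma proj_PSL_hom: "proj_PSL \<in> hom SL2C PSL2C"
  unfolding proj_PSL_def PSL2C_def using normal.r_coset_hom_Mod[OF normal_centre_SL2C] .

lemma group_hom_proj_PSL: "group_hom SL2C PSL2C proj_PSL"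
  by (intro group_hom.intro group_hom_axioms.intro group_SL2C group_PSL2C proj_PSL_hom)

interpretation proj: group_hom SL2C PSL2C proj_PSL
  by (rule group_hom_proj_PSL)

lemma proj_PSL_mult:
  "det A = 1 \<Longrightarrow> det B = 1 \<Longrightarrow> proj_PSL A \<otimes>\<^bsub>PSL2C\<^esub> proj_PSL B = proj_PSL (A ** B)"
  using proj.hom_mult[of A B] by simp

lemma proj_PSL_closed [simp]: "det A = 1 \<Longrightarrow> proj_PSL A \<in> carrier PSL2C"
  using proj.hom_closed[of A] by simp

lemma proj_PSL_inv_mk2:
  "a * d - b * c = 1 \<Longrightarrow> inv\<^bsub>PSL2C\<^esub> proj_PSL (mk2 a b c d) = proj_PSL (mk2 d (- b) (- c) a)"
  using proj.hom_inv[of "mk2 a b c d"] by (simp add: inv_SL2C_mk2)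

lemma proj_PSL_uminus: "proj_PSL (- A) = proj_PSL A"
  by (auto simp: proj_PSL_eq)

lemma proj_PSL_one: "proj_PSL (mat 1) = \<one>\<^bsub>PSL2C\<^esub>"
  using proj.hom_one by simp

lemma PSL2C_cases:
  assumes "h \<in> carrier PSL2C"
  obtains A where "det A = 1" "h = proj_PSL A"
  using assms by (auto simp: carrier_PSL2C)

text \<open>By Cayley--Hamilton \<open>A\<^sup>2 = 2 cos \<theta> A - 1\<close>, hence \<open>sin \<theta> A\<^sup>k = sin (k\<theta>) A - sin ((k - 1)\<theta>)\<close>. The identity is
written out in entries.\<close>

lemma SL2C_power_entries:
  fixes a b c d :: complex and \<theta> :: real
  assumes det: "a * d - b * c = 1" and tr: "a + d = complex_of_real (2 * cos \<theta>)"
  defines "s \<equiv> \<lambda>k::nat. complex_of_real (sin (real k * \<theta>))"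
    and "s' \<equiv> \<lambda>k::nat. complex_of_real (sin (real k * \<theta> - \<theta>))"
  shows "\<exists>x y z w. mk2 a b c d [^]\<^bsub>SL2C\<^esub> k = mk2 x y z w \<and>
    complex_of_real (sin \<theta>) * x = s k * a - s' k \<and> complex_of_real (sin \<theta>) * y = s k * b \<and>
    complex_of_real (sin \<theta>) * z = s k * c \<and> complex_of_real (sin \<theta>) * w = s k * d - s' k"
proof (induction k)
  case 0
  show ?case by (simp add: one_mk2 s_def s'_def)
next
  case (Suc k)
  then obtain x y z w where IH: "mk2 a b c d [^]\<^bsub>SL2C\<^esub> k = mk2 x y z w"
    and e: "complex_of_real (sin \<theta>) * x = s k * a - s' k" "complex_of_real (sin \<theta>) * y = s k * b"
    "complex_of_real (sin \<theta>) * z = s k * c" "complex_of_real (sin \<theta>) * w = s k * d - s' k"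
    by blast
  have "2 * cos \<theta> * sin (real k * \<theta>) = sin (real k * \<theta> + \<theta>) + sin (real k * \<theta> - \<theta>)"
    by (simp add: sin_add sin_diff)
  then have "s (Suc k) = complex_of_real (2 * cos \<theta>) * s k - s' k"
    unfolding s_def s'_def by (simp add: algebra_simps flip: of_real_mult of_real_diff)
  then have rec: "s (Suc k) = (a + d) * s k - s' k" by (simp only: tr)
  have s': "s' (Suc k) = s k" by (simp add: s_def s'_def algebra_simps)
  have bc: "b * c = a * d - 1" using det by (simp add: algebra_simps)
  have lin: "complex_of_real (sin \<theta>) * (p * u + q * v) = (complex_of_real (sin \<theta>) * p) * u + (complex_of_real (sin \<theta>) * q) * v" for p q u v
    by (simp add: algebra_simps)
  have 1: "complex_of_real (sin \<theta>) * (x * a + y * c) = s (Suc k) * a - s' (Suc k)"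
  proof -
    have "complex_of_real (sin \<theta>) * (x * a + y * c) = s k * a * a - s' k * a + s k * (b * c)"
      unfolding lin e by (simp add: algebra_simps)
    also have "\<dots> = s (Suc k) * a - s' (Suc k)" unfolding bc rec s' by (simp add: algebra_simps)
    finally show ?thesis .
  qed
  have 2: "complex_of_real (sin \<theta>) * (x * b + y * d) = s (Suc k) * b"
    unfolding lin e rec by (simp add: algebra_simps)
  have 3: "complex_of_real (sin \<theta>) * (z * a + w * c) = s (Suc k) * c"
    unfolding lin e rec by (simp add: algebra_simps)
  have 4: "complex_of_real (sin \<theta>) * (z * b + w * d) = s (Suc k) * d - s' (Suc k)"
  proof -
    have "complex_of_real (sin \<theta>) * (z * b + w * d) = s k * (b * c) + s k * d * d - s' k * d"
      unfolding lin e by (simp add: algebra_simps)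
    also have "\<dots> = s (Suc k) * d - s' (Suc k)" unfolding bc rec s' by (simp add: algebra_simps)
    finally show ?thesis .
  qed
  have "mk2 a b c d [^]\<^bsub>SL2C\<^esub> Suc k = mk2 (x * a + y * c) (x * b + y * d) (z * a + w * c) (z * b + w * d)"
    by (simp add: IH)
  with 1 2 3 4 show ?case by blast
qed

text \<open>At \<open>\<theta> = \<pi>/m\<close> and \<open>k = m\<close> the formula for the powers gives \<open>A\<^sup>m = -1\<close>; a negative trace is
corrected by the other lift.\<close>

lemma proj_PSL_power_trivial:
  assumes det: "det A = 1" and m: "m \<ge> 2"
    and tr: "trace A = complex_of_real (2 * cos (pi / real m)) \<or>
      trace A = - complex_of_real (2 * cos (pi / real m))"
  shows "proj_PSL A [^]\<^bsub>PSL2C\<^esub> m = \<one>\<^bsub>PSL2C\<^esub>"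
proof -
  have main: "proj_PSL B [^]\<^bsub>PSL2C\<^esub> m = \<one>\<^bsub>PSL2C\<^esub>"
    if B: "det B = 1" "trace B = complex_of_real (2 * cos (pi / real m))" for B
  proof -
    obtain a b c d where e: "B = mk2 a b c d" by (rule mk2_cases)
    define \<theta> where "\<theta> = pi / real m"
    have \<theta>: "0 < \<theta>" "\<theta> < pi" "real m * \<theta> = pi" using m by (auto simp: \<theta>_def field_simps)
    have nz: "sin \<theta> \<noteq> 0" using \<theta> sin_gt_zero[of \<theta>] by auto
    obtain x y z w where p: "mk2 a b c d [^]\<^bsub>SL2C\<^esub> m = mk2 x y z w"
      and "complex_of_real (sin \<theta>) * x = - complex_of_real (sin \<theta>)" "complex_of_real (sin \<theta>) * y = 0"
        "complex_of_real (sin \<theta>) * z = 0" "complex_of_real (sin \<theta>) * w = - complex_of_real (sin \<theta>)"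
      using SL2C_power_entries[of a d b c \<theta> m] B e \<theta> by (auto simp: \<theta>_def)
    then have "B [^]\<^bsub>SL2C\<^esub> m = - mat 1"
      using nz unfolding e p by (simp add: one_mk2 mult_eq_0_iff)
        (metis mult_cancel_left mult_minus1_right of_real_eq_0_iff)
    moreover have "proj_PSL B [^]\<^bsub>PSL2C\<^esub> m = proj_PSL (B [^]\<^bsub>SL2C\<^esub> m)"
      using proj.hom_nat_pow[of B m] B by simp
    ultimately show ?thesis by (simp add: proj_PSL_uminus proj_PSL_one)
  qed
  have "det (- A) = 1" using det by (simp add: det_uminus2)
  then show ?thesis
    using main[of A] main[of "- A"] det tr by (auto simp: trace_uminus2 proj_PSL_uminus)
qed

definition conj_transpose :: "mat2 \<Rightarrow> mat2" where
  "conj_transpose A = mk2 (cnj (A$1$1)) (cnj (A$2$1)) (cnj (A$1$2)) (cnj (A$2$2))"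

text \<open>The space of Hermitian matrices with the quadratic form \<open>-det\<close> is Minkowski space, on which SL(2,C)
acts by isometries; a boundary point \<open>z\<close> corresponds to the ray of \<open>(z,1)(z,1)\<^sup>*\<close>. The formula is
used on all matrices, since the linear forms \<open>face_form\<close> below see only their Hermitian part.\<close>

definition herm_act :: "mat2 \<Rightarrow> mat2 \<Rightarrow> mat2" where
  "herm_act A X = A ** X ** conj_transpose A"

lemma conj_transpose_mult: "conj_transpose (A ** B) = conj_transpose B ** conj_transpose A"
  by (rule mk2_cases[of A], rule mk2_cases[of B]) (simp add: conj_transpose_def mult.commute)

lemma herm_act_mult: "herm_act (A ** B) X = herm_act A (herm_act B X)"
  by (simp add: herm_act_def conj_transpose_mult matrix_mul_assoc)

lemma herm_act_one: "herm_act (mat 1) X = X"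
proof -
  have "conj_transpose (mat 1) = mat 1" by (simp add: conj_transpose_def one_mk2)
  then show ?thesis by (simp add: herm_act_def)
qed

lemma herm_act_uminus: "herm_act (- A) X = herm_act A X"
proof -
  have "conj_transpose (- A) = - conj_transpose A" by (simp add: conj_transpose_def)
  then show ?thesis by (simp add: herm_act_def matrix_mul_uminus_left matrix_mul_uminus_right)
qed

definition psl_act :: "mat2 set \<Rightarrow> mat2 \<Rightarrow> mat2" where
  "psl_act h = herm_act (lift h)"

lemma psl_act_proj: "det A = 1 \<Longrightarrow> psl_act (proj_PSL A) X = herm_act A X"
  using lift_cases[OF proj_PSL_closed, of A A] herm_act_uminus[of A]
  by (auto simp: psl_act_def proj_PSL_eq)

lemma psl_act_mult:
  assumes "h \<in> carrier PSL2C" "k \<in> carrier PSL2C"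
  shows "psl_act (h \<otimes>\<^bsub>PSL2C\<^esub> k) X = psl_act h (psl_act k X)"
  using assms by (elim PSL2C_cases) (simp add: proj_PSL_mult psl_act_proj det_mul herm_act_mult)

lemma psl_act_one: "psl_act \<one>\<^bsub>PSL2C\<^esub> X = X"
  by (simp add: psl_act_proj herm_act_one flip: proj_PSL_one)

text \<open>The faces are named after the mirrors: \<open>FA\<close> is \<open>Re z = 0\<close>, \<open>FS\<close> is \<open>|z + T/2| = 1\<close>, \<open>FB\<close> is
\<open>Im z = 0\<close> and \<open>FC\<close> is \<open>Im z = t/2\<close>.\<close>

datatype face = FA | FS | FB | FC

text \<open>The normal forms \<open>z \<mapsto> T/2 - 1/(z + T/2)\<close> and \<open>z \<mapsto> z + it\<close> of the two generators.\<close>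

definition Fmat :: "real \<Rightarrow> mat2" where
  "Fmat T = mk2 (T / 2) (T\<^sup>2 / 4 - 1) 1 (T / 2)"

definition Gmat :: "real \<Rightarrow> mat2" where
  "Gmat t = mk2 1 (\<i> * t) 0 1"

lemma det_Fmat [simp]: "det (Fmat T) = 1"
  by (simp add: Fmat_def power2_eq_square)

lemma det_Gmat [simp]: "det (Gmat t) = 1"
  by (simp add: Gmat_def)

text \<open>The reflections \<open>z \<mapsto> - cnj z\<close> and \<open>z \<mapsto> cnj z\<close> on Hermitian matrices.\<close>

definition conjA :: "mat2 \<Rightarrow> mat2" where
  "conjA X = mk2 (cnj (X$1$1)) (- cnj (X$1$2)) (- cnj (X$2$1)) (cnj (X$2$2))"

definition conjB :: "mat2 \<Rightarrow> mat2" where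
  "conjB X = mk2 (cnj (X$1$1)) (cnj (X$1$2)) (cnj (X$2$1)) (cnj (X$2$2))"

lemma conj_invol [simp]: "conjA (conjA X) = X" "conjB (conjB X) = X"
  by (simp_all add: conjA_def conjB_def mat2_eq_iff)

lemma conj_commute: "conjA (conjB X) = conjB (conjA X)"
  by (simp add: conjA_def conjB_def)

lemma conjA_herm_act:
  "conjA (herm_act (mk2 a b c d) X) = herm_act (mk2 (cnj a) (- cnj b) (- cnj c) (cnj d)) (conjA X)"
  by (rule mk2_cases[of X]) (simp add: conjA_def herm_act_def conj_transpose_def algebra_simps)

lemma conjB_herm_act:
  "conjB (herm_act (mk2 a b c d) X) = herm_act (mk2 (cnj a) (cnj b) (cnj c) (cnj d)) (conjB X)"
  by (rule mk2_cases[of X]) (simp add: conjB_def herm_act_def conj_transpose_def algebra_simps)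

text \<open>Evaluated at \<open>(z,1)(z,1)\<^sup>*\<close> these are \<open>-2 Re z\<close>, \<open>|z + T/2|\<^sup>2 - 1\<close>, \<open>2 Im z\<close> and \<open>t - 2 Im z\<close>. They are
positive on the chamber that lies to the left of \<open>A\<close>, outside \<open>S\<close> and between \<open>B\<close> and \<open>C\<close>. For \<open>T > 0\<close> the centre
\<open>-T/2\<close> of the circle is on the same side of \<open>A\<close>; this gives the angle with cosine \<open>T/2\<close> between \<open>A\<close> and
\<open>S\<close> rather than its supplement.\<close>

fun face_form :: "real \<Rightarrow> real \<Rightarrow> face \<Rightarrow> mat2 \<Rightarrow> real" where
  "face_form T t FA X = - Re (X$1$2 + X$2$1)"
| "face_form T t FS X = Re (X$1$1) + T / 2 * Re (X$1$2 + X$2$1) + (T\<^sup>2 / 4 - 1) * Re (X$2$2)"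
| "face_form T t FB X = Im (X$1$2 - X$2$1)"
| "face_form T t FC X = t * Re (X$2$2) - Im (X$1$2 - X$2$1)"

text \<open>The reflections \<open>S = Af\<close> and \<open>C = gB\<close> are expressed through the two generators.\<close>

fun face_refl :: "real \<Rightarrow> real \<Rightarrow> face \<Rightarrow> mat2 \<Rightarrow> mat2" where
  "face_refl T t FA X = conjA X"
| "face_refl T t FS X = conjA (herm_act (Fmat T) X)"
| "face_refl T t FB X = conjB X"
| "face_refl T t FC X = herm_act (Gmat t) (conjB X)"

fun face_cos :: "real \<Rightarrow> real \<Rightarrow> face \<Rightarrow> face \<Rightarrow> real" where
  "face_cos T t FA FS = T / 2"
| "face_cos T t FS FA = T / 2"
| "face_cos T t FS FC = t / 2"
| "face_cos T t FC FS = t / 2"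
| "face_cos T t FB FC = 1"
| "face_cos T t FC FB = 1"
| "face_cos T t i j = 0"

lemma face_form_same: "face_form T t i (face_refl T t i X) = - face_form T t i X"
proof -
  obtain r where r: "T = 2 * r" by (metis field_sum_of_halves mult_2)
  obtain a b c d where X: "X = mk2 a b c d" by (rule mk2_cases)
  show ?thesis
    by (cases i) (simp_all add: r X conjA_def conjB_def herm_act_def conj_transpose_def Fmat_def Gmat_def
        algebra_simps power2_eq_square)
qed

lemma face_form_other:
  assumes "i \<noteq> j"
  shows "face_form T t j (face_refl T t i X) = face_form T t j X + 2 * face_cos T t i j * face_form T t i X"
proof -
  obtain r where r: "T = 2 * r" by (metis field_sum_of_halves mult_2)
  obtain a b c d where X: "X = mk2 a b c d" by (rule mk2_cases)
  show ?thesis using assms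
    by (cases i; cases j) (simp_all add: r X conjA_def conjB_def herm_act_def conj_transpose_def Fmat_def Gmat_def
        algebra_simps power2_eq_square)
qed

text \<open>The real part \<open>-(T/2 + 1)\<close> puts \<open>z\<close> on the vertical line through the leftmost point \<open>-T/2 - 1\<close> of the
circle, and the imaginary part \<open>t/4\<close> lies halfway between \<open>B\<close> and \<open>C\<close>.\<close>

definition chamber_point :: "real \<Rightarrow> real \<Rightarrow> mat2" where
  "chamber_point T t = (let z = Complex (- (T / 2 + 1)) (t / 4) in mk2 (z * cnj z) z (cnj z) 1)"

lemma chamber_point_pos:
  assumes "T \<ge> 0" "t > 0"
  shows "face_form T t i (chamber_point T t) > 0"
  using assms by (cases i) (simp_all add: chamber_point_def Let_def power2_eq_square algebra_simps add_pos_nonneg)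

section \<open>The group GT acting on chambers\<close>

lemma (in group) cancel_left [simp]:
  assumes "x \<in> carrier G" "z \<in> carrier G"
  shows "inv x \<otimes> (x \<otimes> z) = z" "x \<otimes> (inv x \<otimes> z) = z"
  using assms by (simp_all add: m_assoc[symmetric])

lemma (in group) pow_conj_inv:
  assumes [simp]: "x \<in> carrier G" "y \<in> carrier G" and y: "y [^] (k::int) = \<one>"
  shows "(x \<otimes> inv y \<otimes> inv x) [^] k = \<one>"
proof -
  have "(x \<otimes> inv y \<otimes> inv x) [^] j = x \<otimes> inv (y [^] j) \<otimes> inv x" for j :: nat
  proof (induction j)
    case (Suc j)
    have "(x \<otimes> inv y \<otimes> inv x) [^] Suc j = (x \<otimes> inv (y [^] j) \<otimes> inv x) \<otimes> (x \<otimes> inv y \<otimes> inv x)"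
      by (simp only: nat_pow_Suc Suc)
    also have "\<dots> = x \<otimes> (inv (y [^] j) \<otimes> inv y) \<otimes> inv x"
      by (simp add: m_assoc)
    also have "inv (y [^] j) \<otimes> inv y = inv (y [^] Suc j)"
      by (simp only: nat_pow_Suc2 assms(1,2) nat_pow_closed inv_mult_group)
    finally show ?case .
  qed simp
  then have nat: "(x \<otimes> inv y \<otimes> inv x) [^] j = \<one>" if "y [^] j = \<one>" for j :: nat
    by (simp add: that)
  show ?thesis
  proof (cases k rule: int_cases2)
    case (nonneg j)
    then show ?thesis using y nat[of j] by (simp only: int_pow_int)
  next
    case (nonpos j)
    have "inv (y [^] j) = \<one>" using y by (simp only: nonpos int_pow_neg_int assms)
    then have "inv (inv (y [^] j)) = \<one>" by (simp only: inv_one)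
    then have "y [^] j = \<one>" by (simp only: inv_inv nat_pow_closed assms)
    then have "(x \<otimes> inv y \<otimes> inv x) [^] j = \<one>" by (rule nat)
    then show ?thesis by (simp add: nonpos int_pow_neg_int)
  qed
qed

lemma (in group_assignment) pow_rel_trivial:
  assumes "r \<in> pow_rel w e" "\<And>k. e = Fin k \<Longrightarrow> eval_word H h w [^] k = \<one>"
  shows "eval_word H h r = \<one>"
  using assms by (auto simp: pow_rel_def split: exponent.splits)

lemma pow_rel_holds:
  assumes "pow_rel w (Fin k) \<subseteq> R"
  shows "eval_word (presented_group R) (pres_gen R) w [^]\<^bsub>presented_group R\<^esub> k = \<one>\<^bsub>presented_group R\<^esub>"
proof -
  interpret group_assignment "presented_group R" "pres_gen R" by (rule group_assignment_pres_gen)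
  have "wpow w k \<in> R" using assms by (simp add: pow_rel_def)
  then show ?thesis using relator_trivial[of "wpow w k" R] by simp
qed

text \<open>Conjugation by a mirror \<open>\<kappa>\<close> of the image of \<open>P\<close> is realised by the automorphism \<open>\<sigma>\<close> of \<open>P\<close>, as soon as this holds
on generators.\<close>

lemma intertwine:
  assumes "group_hom (presented_group R) PSL2C \<phi>" "group_hom (presented_group R) (presented_group R) \<sigma>"
    and gens: "\<And>x X. \<kappa> (psl_act (\<phi> (pres_gen R x)) X) = psl_act (\<phi> (\<sigma> (pres_gen R x))) (\<kappa> X)"
    and p: "p \<in> carrier (presented_group R)"
  shows "\<kappa> (psl_act (\<phi> p) X) = psl_act (\<phi> (\<sigma> p)) (\<kappa> X)"
proof -
  interpret f: group_hom "presented_group R" PSL2C \<phi> by fact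
  interpret s: group_hom "presented_group R" "presented_group R" \<sigma> by fact
  have inv_act: "psl_act (inv\<^bsub>PSL2C\<^esub> h) (psl_act h Y) = Y" "psl_act h (psl_act (inv\<^bsub>PSL2C\<^esub> h) Y) = Y"
    if "h \<in> carrier PSL2C" for h Y
    using that by (simp_all add: psl_act_one flip: psl_act_mult)
  from p show ?thesis
  proof (induction arbitrary: X rule: presented_group_induct)
    case one
    then show ?case by (simp add: psl_act_one)
  next
    case (mult x p)
    then show ?case by (simp add: psl_act_mult gens)
  next
    case (inv x p)
    define Y where "Y = psl_act (\<phi> (inv\<^bsub>presented_group R\<^esub> pres_gen R x)) (psl_act (\<phi> p) X)"
    have "psl_act (\<phi> (\<sigma> (pres_gen R x))) (\<kappa> Y) = \<kappa> (psl_act (\<phi> p) X)"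
      unfolding gens[symmetric] Y_def by (simp add: inv_act)
    then have "\<kappa> Y = psl_act (inv\<^bsub>PSL2C\<^esub> \<phi> (\<sigma> (pres_gen R x))) (\<kappa> (psl_act (\<phi> p) X))"
      using inv_act(1)[of "\<phi> (\<sigma> (pres_gen R x))" "\<kappa> Y"] by simp
    then show ?case using inv Y_def by (simp add: psl_act_mult)
  qed
qed

text \<open>The number \<open>c\<close> attached to two mirrors is compatible with the order \<open>e\<close> of the product of the reflections.\<close>

definition angle_exponent :: "exponent \<Rightarrow> real \<Rightarrow> bool" where
  "angle_exponent e c \<longleftrightarrow>
     (\<exists>k::nat. k \<ge> 2 \<and> e = Fin (int k) \<and> c = cos (pi / real k)) \<or> ((e = Infty \<or> e = BarInfty) \<and> c \<ge> 1)"

lemma angle_exponent_Fin: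
  assumes "angle_exponent e c" "e = Fin k"
  obtains m :: nat where "m \<ge> 2" "k = int m" "c = cos (pi / real m)"
  using assms by (auto simp: angle_exponent_def)

lemma psl_power_trivial_int:
  assumes "det A = 1" "m \<ge> 2"
    and "trace A = complex_of_real (2 * cos (pi / real m)) \<or>
      trace A = - complex_of_real (2 * cos (pi / real m))"
  shows "proj_PSL A [^]\<^bsub>PSL2C\<^esub> int m = \<one>\<^bsub>PSL2C\<^esub>"
  using proj_PSL_power_trivial[OF assms] by (simp add: int_pow_int)

lemma inv_proj_F: "inv\<^bsub>PSL2C\<^esub> proj_PSL (Fmat T) =
    proj_PSL (mk2 (T / 2) (1 - complex_of_real (T\<^sup>2 / 4)) (- 1) (T / 2))"
  unfolding Fmat_def by (subst proj_PSL_inv_mk2) (simp_all add: power2_eq_square)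

lemma inv_proj_G: "inv\<^bsub>PSL2C\<^esub> proj_PSL (Gmat t) = proj_PSL (mk2 1 (- (\<i> * t)) 0 1)"
  unfolding Gmat_def by (subst proj_PSL_inv_mk2) simp_all

lemma conjA_psl_F: "conjA (psl_act (proj_PSL (Fmat T)) Y) = psl_act (inv\<^bsub>PSL2C\<^esub> proj_PSL (Fmat T)) (conjA Y)"
proof -
  have "det (mk2 (T / 2) (1 - complex_of_real (T\<^sup>2 / 4)) (- 1) (T / 2)) = 1"
    by (simp add: power2_eq_square)
  then show ?thesis unfolding inv_proj_F psl_act_proj[OF det_Fmat]
    by (subst psl_act_proj) (simp_all only: Fmat_def conjA_herm_act, simp)
qed

lemma conjA_psl_G: "conjA (psl_act (proj_PSL (Gmat t)) Y) = psl_act (proj_PSL (Gmat t)) (conjA Y)"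
  unfolding psl_act_proj[OF det_Gmat] by (simp only: Gmat_def conjA_herm_act) simp

lemma conjB_psl_F: "conjB (psl_act (proj_PSL (Fmat T)) Y) = psl_act (proj_PSL (Fmat T)) (conjB Y)"
  unfolding psl_act_proj[OF det_Fmat] by (simp only: Fmat_def conjB_herm_act) simp

lemma conjB_psl_G: "conjB (psl_act (proj_PSL (Gmat t)) Y) = psl_act (inv\<^bsub>PSL2C\<^esub> proj_PSL (Gmat t)) (conjB Y)"
proof -
  have "det (mk2 1 (- (\<i> * t)) 0 1) = 1" by simp
  then show ?thesis unfolding inv_proj_G psl_act_proj[OF det_Gmat]
    by (subst psl_act_proj) (simp_all only: Gmat_def conjB_herm_act, simp)
qed

lemma dihedral_pair_commute:
  assumes "\<And>x. x \<in> X \<Longrightarrow> s i (s j (s i (s j x))) = x"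
  shows "dihedral_pair X s 0 i j"
proof -
  have "((s i \<circ> s j) ^^ 2) x = x" if "x \<in> X" for x
    using assms[OF that] by (simp only: numeral_2_eq_2 funpow.simps o_apply id_apply)
  moreover have "(0::real) = cos (pi / real 2)" by simp
  ultimately show ?thesis unfolding dihedral_pair_def by blast
qed

locale face_angles =
  fixes T t :: real and n :: exponent
  assumes T_nonneg: "T \<ge> 0" and t_pos: "t > 0" and angle_n: "angle_exponent n (T / 2)"

lemma trace_F: "trace (Fmat T) = complex_of_real T"
  by (simp add: Fmat_def)

lemma (in face_angles) F_power:
  assumes "n = Fin k"
  shows "proj_PSL (Fmat T) [^]\<^bsub>PSL2C\<^esub> k = \<one>\<^bsub>PSL2C\<^esub>"
proof -
  obtain m where m: "m \<ge> 2" "k = int m" "T / 2 = cos (pi / real m)"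
    using angle_exponent_Fin[OF angle_n assms] .
  have "T = 2 * cos (pi / real m)" using m(3) by simp
  then have "trace (Fmat T) = complex_of_real (2 * cos (pi / real m))" by (simp only: trace_F)
  from psl_power_trivial_int[OF det_Fmat m(1) disjI1[OF this]] show ?thesis by (simp only: m(2))
qed

definition GT_relators :: "exponent \<Rightarrow> exponent \<Rightarrow> GT_gen gword set" where
  "GT_relators n e = pow_rel (gen GTf) n \<union>
     pow_rel (gen GTf @ gen GTg @ winv (gen GTf) @ winv (gen GTg)) e"

lemma GT_presented: "GT n Infty e = presented_group (GT_relators n e)"
  by (simp add: GT_def GT_relators_def Let_def pow_rel_def)

lemma GT_presented_homI:
  assumes "group H" "a \<in> carrier H" "b \<in> carrier H"
    and "\<And>k. n = Fin k \<Longrightarrow> a [^]\<^bsub>H\<^esub> k = \<one>\<^bsub>H\<^esub>"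
    and "\<And>k. e = Fin k \<Longrightarrow> (a \<otimes>\<^bsub>H\<^esub> (b \<otimes>\<^bsub>H\<^esub> (inv\<^bsub>H\<^esub> a \<otimes>\<^bsub>H\<^esub> inv\<^bsub>H\<^esub> b))) [^]\<^bsub>H\<^esub> k = \<one>\<^bsub>H\<^esub>"
  shows "presented_hom H (case_GT_gen a b) (GT_relators n e)"
proof -
  interpret group_assignment H "case_GT_gen a b"
    using assms(1-3) by (intro group_assignment.intro group_assignment_axioms.intro)
      (auto split: GT_gen.splits)
  show ?thesis
  proof
    fix r assume "r \<in> GT_relators n e"
    then consider (power) "r \<in> pow_rel (gen GTf) n"
      | (comm) "r \<in> pow_rel (gen GTf @ gen GTg @ winv (gen GTf) @ winv (gen GTg)) e"
      unfolding GT_relators_def by blast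
    then show "eval_word H (case_GT_gen a b) r = \<one>\<^bsub>H\<^esub>"
    proof cases
      case power
      then show ?thesis by (rule pow_rel_trivial) (simp add: assms(4))
    next
      case comm
      then show ?thesis by (rule pow_rel_trivial) (simp add: assms(5))
    qed
  qed
qed

text \<open>The mirrors \<open>S\<close> and \<open>C\<close> meet at the angle \<open>\<pi>/(2q)\<close> rather than \<open>\<pi>/q\<close>, because it is
\<open>(SC)\<^sup>2\<close> that is conjugate to the commutator of \<open>f\<close> and \<open>g\<close>.\<close>

locale GT_rep = face_angles +
  fixes e :: exponent
  assumes angle_e: "(\<exists>q::nat. q \<ge> 2 \<and> e = Fin (int q) \<and> t / 2 = cos (pi / real (2 * q))) \<or>
    ((e = Infty \<or> e = BarInfty) \<and> t / 2 \<ge> 1)"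
begin

abbreviation "R \<equiv> GT_relators n e"
abbreviation "P \<equiv> presented_group R"
abbreviation "f \<equiv> pres_gen R GTf"
abbreviation "g \<equiv> pres_gen R GTg"

sublocale P: group_assignment P "pres_gen R" by (rule group_assignment_pres_gen)

lemma f_power:
  assumes "n = Fin k"
  shows "f [^]\<^bsub>P\<^esub> k = \<one>\<^bsub>P\<^esub>"
proof -
  have "pow_rel (gen GTf) (Fin k) \<subseteq> R" using assms by (auto simp: GT_relators_def)
  from pow_rel_holds[OF this] show ?thesis by simp
qed

lemma comm_power:
  assumes "e = Fin k"
  shows "(f \<otimes>\<^bsub>P\<^esub> (g \<otimes>\<^bsub>P\<^esub> (inv\<^bsub>P\<^esub> f \<otimes>\<^bsub>P\<^esub> inv\<^bsub>P\<^esub> g))) [^]\<^bsub>P\<^esub> k = \<one>\<^bsub>P\<^esub>"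
proof -
  have "pow_rel (gen GTf @ gen GTg @ winv (gen GTf) @ winv (gen GTg)) (Fin k) \<subseteq> R"
    using assms by (auto simp: GT_relators_def)
  from pow_rel_holds[OF this] show ?thesis by simp
qed

text \<open>The images of the commutator under \<open>f \<mapsto> f\<^sup>-\<^sup>1\<close> and under \<open>g \<mapsto> g\<^sup>-\<^sup>1\<close> are conjugate to its inverse. This
makes both substitutions automorphisms of \<open>P\<close>.\<close>

lemma comm_power':
  assumes "e = Fin k"
  shows "(inv\<^bsub>P\<^esub> f \<otimes>\<^bsub>P\<^esub> (g \<otimes>\<^bsub>P\<^esub> (f \<otimes>\<^bsub>P\<^esub> inv\<^bsub>P\<^esub> g))) [^]\<^bsub>P\<^esub> k = \<one>\<^bsub>P\<^esub>"
    and "(f \<otimes>\<^bsub>P\<^esub> (inv\<^bsub>P\<^esub> g \<otimes>\<^bsub>P\<^esub> (inv\<^bsub>P\<^esub> f \<otimes>\<^bsub>P\<^esub> g))) [^]\<^bsub>P\<^esub> k = \<one>\<^bsub>P\<^esub>"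
  using P.pow_conj_inv[OF _ _ comm_power[OF assms], of "inv\<^bsub>P\<^esub> f"]
    P.pow_conj_inv[OF _ _ comm_power[OF assms], of "inv\<^bsub>P\<^esub> g"]
  by (simp_all add: P.inv_mult_group P.m_assoc)

text \<open>The commutator has trace \<open>2 - t\<^sup>2 = 2 - 4 cos\<^sup>2(\<pi>/(2q)) = -2 cos(\<pi>/q)\<close>.\<close>

lemma comm_power_psl:
  assumes "e = Fin k"
  shows "(proj_PSL (Fmat T) \<otimes>\<^bsub>PSL2C\<^esub> (proj_PSL (Gmat t) \<otimes>\<^bsub>PSL2C\<^esub>
      (inv\<^bsub>PSL2C\<^esub> proj_PSL (Fmat T) \<otimes>\<^bsub>PSL2C\<^esub> inv\<^bsub>PSL2C\<^esub> proj_PSL (Gmat t)))) [^]\<^bsub>PSL2C\<^esub> k = \<one>\<^bsub>PSL2C\<^esub>"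
proof -
  obtain q where q: "q \<ge> 2" "k = int q" "t / 2 = cos (pi / real (2 * q))"
    using angle_e assms by auto
  have t: "t = 2 * cos (pi / real (2 * q))" using q(3) by simp
  have "2 - t\<^sup>2 = - (2 * cos (pi / real q))"
    unfolding t using cos_double_cos[of "pi / real (2 * q)"] by (simp add: power_mult_distrib)
  then have "complex_of_real (2 - t\<^sup>2) = complex_of_real (- (2 * cos (pi / real q)))" by (simp only:)
  then have tt: "2 - complex_of_real t * complex_of_real t = - complex_of_real (2 * cos (pi / real q))"
    by (simp add: power2_eq_square)
  define F' where "F' = mk2 (T / 2) (- complex_of_real (T\<^sup>2 / 4 - 1)) (- 1) (T / 2)"
  define G' where "G' = mk2 1 (- (\<i> * t)) 0 1"
  define C where "C = Fmat T ** (Gmat t ** (F' ** G'))"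
  have d: "det F' = 1" "det G' = 1" by (simp_all add: F'_def G'_def power2_eq_square)
  have inv: "inv\<^bsub>PSL2C\<^esub> proj_PSL (Fmat T) = proj_PSL F'" "inv\<^bsub>PSL2C\<^esub> proj_PSL (Gmat t) = proj_PSL G'"
    unfolding Fmat_def Gmat_def F'_def G'_def
    by (subst proj_PSL_inv_mk2; simp add: power2_eq_square)+
  have C: "proj_PSL (Fmat T) \<otimes>\<^bsub>PSL2C\<^esub> (proj_PSL (Gmat t) \<otimes>\<^bsub>PSL2C\<^esub>
      (inv\<^bsub>PSL2C\<^esub> proj_PSL (Fmat T) \<otimes>\<^bsub>PSL2C\<^esub> inv\<^bsub>PSL2C\<^esub> proj_PSL (Gmat t))) = proj_PSL C"
    unfolding inv by (simp add: proj_PSL_mult det_mul d C_def)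
  obtain r where r: "T = 2 * r" by (metis field_sum_of_halves mult_2)
  have "trace C = 2 - complex_of_real t * complex_of_real t"
    by (simp add: C_def Fmat_def Gmat_def F'_def G'_def r algebra_simps power2_eq_square)
  then have tr: "trace C = - complex_of_real (2 * cos (pi / real q))" by (simp only: tt)
  have dC: "det C = 1" by (simp add: C_def det_mul d)
  have "proj_PSL C [^]\<^bsub>PSL2C\<^esub> int q = \<one>\<^bsub>PSL2C\<^esub>"
    by (rule psl_power_trivial_int[OF dC q(1) disjI2[OF tr]])
  then show ?thesis by (simp only: C q(2))
qed

lemma presented_hom_psl:
  "presented_hom PSL2C (case_GT_gen (proj_PSL (Fmat T)) (proj_PSL (Gmat t))) R"
  by (rule GT_presented_homI[OF group_PSL2C]) (simp_all only: proj_PSL_closed det_Fmat det_Gmat F_power comm_power_psl)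

sublocale \<phi>: presented_hom PSL2C "case_GT_gen (proj_PSL (Fmat T)) (proj_PSL (Gmat t))" R
  by (rule presented_hom_psl)

text \<open>Conjugation by \<open>A\<close> maps \<open>f = AS\<close> to its inverse and, since \<open>A\<close> commutes with \<open>B\<close> and \<open>C\<close>, fixes \<open>g = CB\<close>.\<close>

lemma presented_hom_\<alpha>: "presented_hom P (case_GT_gen (inv\<^bsub>P\<^esub> f) g) R"
proof (rule GT_presented_homI)
  show "inv\<^bsub>P\<^esub> f [^]\<^bsub>P\<^esub> k = \<one>\<^bsub>P\<^esub>" if "n = Fin k" for k
    using f_power[OF that] by (simp add: P.int_pow_inv)
  show "(inv\<^bsub>P\<^esub> f \<otimes>\<^bsub>P\<^esub> (g \<otimes>\<^bsub>P\<^esub> (inv\<^bsub>P\<^esub> (inv\<^bsub>P\<^esub> f) \<otimes>\<^bsub>P\<^esub> inv\<^bsub>P\<^esub> g))) [^]\<^bsub>P\<^esub> k = \<one>\<^bsub>P\<^esub>"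
    if "e = Fin k" for k
    using comm_power'(1)[OF that] by simp
qed (simp_all add: P.is_group)

text \<open>Conjugation by \<open>B\<close> fixes \<open>f = AS\<close>, since \<open>B\<close> commutes with \<open>A\<close> and \<open>S\<close>, and maps \<open>g = CB\<close> to its inverse.\<close>

lemma presented_hom_\<beta>: "presented_hom P (case_GT_gen f (inv\<^bsub>P\<^esub> g)) R"
proof (rule GT_presented_homI)
  show "f [^]\<^bsub>P\<^esub> k = \<one>\<^bsub>P\<^esub>" if "n = Fin k" for k
    using f_power[OF that] .
  show "(f \<otimes>\<^bsub>P\<^esub> (inv\<^bsub>P\<^esub> g \<otimes>\<^bsub>P\<^esub> (inv\<^bsub>P\<^esub> f \<otimes>\<^bsub>P\<^esub> inv\<^bsub>P\<^esub> (inv\<^bsub>P\<^esub> g)))) [^]\<^bsub>P\<^esub> k = \<one>\<^bsub>P\<^esub>"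
    if "e = Fin k" for k
    using comm_power'(2)[OF that] by simp
qed (simp_all add: P.is_group)

sublocale \<alpha>: presented_hom P "case_GT_gen (inv\<^bsub>P\<^esub> f) g" R
  by (rule presented_hom_\<alpha>)

sublocale \<beta>: presented_hom P "case_GT_gen f (inv\<^bsub>P\<^esub> g)" R
  by (rule presented_hom_\<beta>)

abbreviation "\<phi> \<equiv> \<phi>.induced"
abbreviation "\<alpha> \<equiv> \<alpha>.induced"
abbreviation "\<beta> \<equiv> \<beta>.induced"

lemma \<alpha>_\<alpha>: "p \<in> carrier P \<Longrightarrow> \<alpha> (\<alpha> p) = p"
  by (induction rule: presented_group_induct) (auto split: GT_gen.splits)

lemma \<beta>_\<beta>: "p \<in> carrier P \<Longrightarrow> \<beta> (\<beta> p) = p"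
  by (induction rule: presented_group_induct) (auto split: GT_gen.splits)

lemma \<alpha>_\<beta>: "p \<in> carrier P \<Longrightarrow> \<alpha> (\<beta> p) = \<beta> (\<alpha> p)"
  by (induction rule: presented_group_induct) (auto split: GT_gen.splits)


definition seed :: "bool \<times> bool \<Rightarrow> mat2" where
  "seed k = (if fst k then conjA else id) ((if snd k then conjB else id) (chamber_point T t))"

definition point :: "GT_gen gword set \<times> bool \<times> bool \<Rightarrow> mat2" where
  "point x = psl_act (\<phi> (fst x)) (seed (snd x))"

definition X :: "(GT_gen gword set \<times> bool \<times> bool) set" where
  "X = carrier P \<times> UNIV"

text \<open>Left multiplication in the semidirect product of \<open>P\<close> with the group of order four generated by \<open>A\<close> and \<open>B\<close>:
an element is a triple \<open>(p, a, b)\<close> standing for \<open>p A\<^sup>a B\<^sup>b\<close>, and \<open>S = Af\<close>, \<open>C = gB\<close>.\<close>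

fun refl :: "face \<Rightarrow> GT_gen gword set \<times> bool \<times> bool \<Rightarrow> GT_gen gword set \<times> bool \<times> bool" where
  "refl FA (p, a, b) = (\<alpha> p, \<not> a, b)"
| "refl FS (p, a, b) = (\<alpha> (f \<otimes>\<^bsub>P\<^esub> p), \<not> a, b)"
| "refl FB (p, a, b) = (\<beta> p, a, \<not> b)"
| "refl FC (p, a, b) = (g \<otimes>\<^bsub>P\<^esub> \<beta> p, a, \<not> b)"

lemma conjA_psl_act:
  assumes "p \<in> carrier P"
  shows "conjA (psl_act (\<phi> p) Y) = psl_act (\<phi> (\<alpha> p)) (conjA Y)"
proof (rule intertwine[OF \<phi>.group_hom_induced \<alpha>.group_hom_induced _ assms])
  fix x Y
  show "conjA (psl_act (\<phi> (pres_gen R x)) Y) = psl_act (\<phi> (\<alpha> (pres_gen R x))) (conjA Y)"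
    by (cases x) (simp_all add: conjA_psl_F conjA_psl_G)
qed

lemma conjB_psl_act:
  assumes "p \<in> carrier P"
  shows "conjB (psl_act (\<phi> p) Y) = psl_act (\<phi> (\<beta> p)) (conjB Y)"
proof (rule intertwine[OF \<phi>.group_hom_induced \<beta>.group_hom_induced _ assms])
  fix x Y
  show "conjB (psl_act (\<phi> (pres_gen R x)) Y) = psl_act (\<phi> (\<beta> (pres_gen R x))) (conjB Y)"
    by (cases x) (simp_all add: conjB_psl_F conjB_psl_G)
qed

text \<open>The abstract mirrors act on chambers as the geometric ones do on Hermitian forms, so the coordinates
\<open>face_form T t i (point x)\<close> transform as \<open>reflection_set\<close> demands.\<close>

lemma point_refl:
  assumes "x \<in> X"
  shows "point (refl i x) = face_refl T t i (point x)"
proof -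
  obtain p a b where x: "x = (p, a, b)" "p \<in> carrier P" using assms by (auto simp: X_def)
  have A: "seed (\<not> a, b) = conjA (seed (a, b))" and B: "seed (a, \<not> b) = conjB (seed (a, b))"
    by (auto simp: seed_def conj_commute)
  have F: "\<phi> (f \<otimes>\<^bsub>P\<^esub> p) = proj_PSL (Fmat T) \<otimes>\<^bsub>PSL2C\<^esub> \<phi> p" using x by simp
  show ?thesis
    using x
    by (cases i) (simp_all add: point_def A B conjA_psl_act[symmetric] conjB_psl_act[symmetric] F
        psl_act_mult psl_act_proj del: \<alpha>.ind.hom_mult)
qed

lemma refl_closed: "x \<in> X \<Longrightarrow> refl i x \<in> X"
  by (cases i; cases x) (auto simp: X_def)

lemma refl_invol: "x \<in> X \<Longrightarrow> refl i (refl i x) = x"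
  by (cases i; cases x) (auto simp: X_def \<alpha>_\<alpha> \<beta>_\<beta>)

text \<open>Both generators of \<open>P\<close> and their inverses are products of two mirrors: \<open>f = AS\<close> and \<open>g = CB\<close>.\<close>

lemma refl_reach:
  assumes "x \<in> X"
  shows "\<exists>w. foldr refl w (\<one>\<^bsub>P\<^esub>, False, False) = x"
proof -
  define Q where "Q = {x. \<exists>w. foldr refl w (\<one>\<^bsub>P\<^esub>, False, False) = x}"
  have step: "refl i y \<in> Q" if yQ: "y \<in> Q" for i y
  proof -
    obtain w where "foldr refl w (\<one>\<^bsub>P\<^esub>, False, False) = y" using yQ by (auto simp: Q_def)
    then have "foldr refl (i # w) (\<one>\<^bsub>P\<^esub>, False, False) = refl i y" by simp
    then show ?thesis unfolding Q_def by blast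
  qed
  have base: "(\<one>\<^bsub>P\<^esub>, a, b) \<in> Q" for a b
  proof -
    have 0: "(\<one>\<^bsub>P\<^esub>, False, False) \<in> Q" unfolding Q_def by (auto intro: exI[of _ "[]"])
    show ?thesis using 0 step[OF 0, of FA] step[OF 0, of FB] step[OF step[OF 0, of FA], of FB]
      by (cases a; cases b) simp_all
  qed
  have "(p, k) \<in> Q" if p: "p \<in> carrier P" for p k
    using p
  proof (induction rule: presented_group_induct)
    case one
    show ?case using base by (cases k) simp
  next
    case (mult y p)
    obtain a b where k: "k = (a, b)" by (cases k)
    have "refl FA (refl FS (p, k)) = (f \<otimes>\<^bsub>P\<^esub> p, k)" "refl FC (refl FB (p, k)) = (g \<otimes>\<^bsub>P\<^esub> p, k)"
      using mult(1) k by (simp_all add: \<alpha>_\<alpha> \<beta>_\<beta>)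
    then show ?case using step[OF step[OF mult(2)]] by (cases y) metis+
  next
    case (inv y p)
    obtain a b where k: "k = (a, b)" by (cases k)
    have "refl FS (refl FA (p, k)) = (inv\<^bsub>P\<^esub> f \<otimes>\<^bsub>P\<^esub> p, k)"
      "refl FB (refl FC (p, k)) = (inv\<^bsub>P\<^esub> g \<otimes>\<^bsub>P\<^esub> p, k)"
      using inv(1) k by (simp_all add: \<alpha>_\<alpha> \<beta>_\<beta>)
    then show ?case using step[OF step[OF inv(2)]] by (cases y) metis+
  qed
  then have "x \<in> Q" using assms by (cases x) (auto simp: X_def)
  then show ?thesis by (simp add: Q_def)
qed

lemma pair_AS: "dihedral_pair X refl (T / 2) FA FS"
proof (cases "T / 2 \<ge> 1")
  case False
  then obtain m where m: "m \<ge> 2" "n = Fin (int m)" "T / 2 = cos (pi / real m)"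
    using angle_n by (auto simp: angle_exponent_def)
  have pow: "((refl FA \<circ> refl FS) ^^ k) (p, c) = (f [^]\<^bsub>P\<^esub> k \<otimes>\<^bsub>P\<^esub> p, c)"
    if p: "p \<in> carrier P" for p c k
  proof (induction k)
    case (Suc k)
    have "f [^]\<^bsub>P\<^esub> Suc k \<otimes>\<^bsub>P\<^esub> p = f \<otimes>\<^bsub>P\<^esub> (f [^]\<^bsub>P\<^esub> k \<otimes>\<^bsub>P\<^esub> p)"
      using p P.nat_pow_Suc2[of f k] by (simp add: P.m_assoc del: P.nat_pow_Suc)
    then show ?case using Suc p by (cases c) (simp add: \<alpha>_\<alpha> del: P.nat_pow_Suc \<alpha>.ind.hom_mult)
  qed (use p in simp)
  have "((refl FA \<circ> refl FS) ^^ m) x = x" if x: "x \<in> X" for x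
  proof -
    obtain p c where "x = (p, c)" "p \<in> carrier P" using x by (auto simp: X_def)
    then show ?thesis using pow[of p m c] f_power[OF m(2)] by (simp add: int_pow_int)
  qed
  then show ?thesis unfolding dihedral_pair_def using m by blast
qed (simp add: dihedral_pair_def)

text \<open>Moving \<open>A\<close> and \<open>B\<close> to the right turns \<open>(SC)\<^sup>2\<close> into left multiplication by \<open>f\<^sup>-\<^sup>1 g f g\<^sup>-\<^sup>1\<close>, whose \<open>q\<close>-th
power is trivial.\<close>

lemma pair_SC: "dihedral_pair X refl (t / 2) FS FC"
proof (cases "t / 2 \<ge> 1")
  case False
  then obtain q where q: "q \<ge> 2" "e = Fin (int q)" "t / 2 = cos (pi / real (2 * q))"
    using angle_e by auto
  let ?u = "inv\<^bsub>P\<^esub> f \<otimes>\<^bsub>P\<^esub> (g \<otimes>\<^bsub>P\<^esub> (f \<otimes>\<^bsub>P\<^esub> inv\<^bsub>P\<^esub> g))"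
  have pow: "((refl FS \<circ> refl FC) ^^ (2 * k)) (p, c) = (?u [^]\<^bsub>P\<^esub> k \<otimes>\<^bsub>P\<^esub> p, c)"
    if p: "p \<in> carrier P" for p c k
  proof (induction k)
    case (Suc k)
    have "?u [^]\<^bsub>P\<^esub> Suc k \<otimes>\<^bsub>P\<^esub> p = ?u \<otimes>\<^bsub>P\<^esub> (?u [^]\<^bsub>P\<^esub> k \<otimes>\<^bsub>P\<^esub> p)"
      using p P.nat_pow_Suc2[of ?u k] by (simp add: P.m_assoc del: P.nat_pow_Suc)
    moreover have "(refl FS \<circ> refl FC) ((refl FS \<circ> refl FC) (y, c)) = (?u \<otimes>\<^bsub>P\<^esub> y, c)"
      if y: "y \<in> carrier P" for y
      using y by (cases c) (simp add: \<alpha>_\<alpha> \<beta>_\<beta> \<alpha>_\<beta> P.m_assoc)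
    ultimately show ?case using Suc p by (simp del: P.nat_pow_Suc refl.simps)
  qed (use p in simp)
  have "((refl FS \<circ> refl FC) ^^ (2 * q)) x = x" if x: "x \<in> X" for x
  proof -
    obtain p c where "x = (p, c)" "p \<in> carrier P" using x by (auto simp: X_def)
    then show ?thesis using pow[of p q c] comm_power'(1)[OF q(2)] by (simp add: int_pow_int)
  qed
  then show ?thesis unfolding dihedral_pair_def using q
    by (intro disjI2 exI[of _ "2 * q"]) auto
qed (simp add: dihedral_pair_def)

lemma pair_commute:
  "dihedral_pair X refl 0 FA FB" "dihedral_pair X refl 0 FA FC" "dihedral_pair X refl 0 FB FS"
  by (rule dihedral_pair_commute; auto simp: X_def \<alpha>_\<alpha> \<beta>_\<beta> \<alpha>_\<beta>)+

sublocale reflection_set X refl "(\<one>\<^bsub>P\<^esub>, False, False)" "\<lambda>i x. face_form T t i (point x)" "face_cos T t"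
proof
  fix i j :: face
  have "dihedral_pair X refl 1 FB FC" by (simp add: dihedral_pair_def)
  then show "i \<noteq> j \<Longrightarrow> dihedral_pair X refl (face_cos T t i j) i j \<or> dihedral_pair X refl (face_cos T t i j) j i"
    using pair_AS pair_SC pair_commute by (cases i; cases j) simp_all
  show "face_cos T t i j = face_cos T t j i" by (cases i; cases j) simp_all
  show "face_form T t i (point (\<one>\<^bsub>P\<^esub>, False, False)) > 0"
    using chamber_point_pos[OF T_nonneg t_pos] by (simp add: point_def psl_act_one seed_def)
qed (auto simp: refl_closed refl_invol refl_reach point_refl face_form_same face_form_other, simp add: X_def)

lemma faithful:
  assumes "p \<in> carrier P" "\<phi> p = \<one>\<^bsub>PSL2C\<^esub>"
  shows "p = \<one>\<^bsub>P\<^esub>"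
proof -
  have "(p, False, False) = (\<one>\<^bsub>P\<^esub>, False, False)"
    using assms chamber_point_pos[OF T_nonneg t_pos]
    by (intro base_only_positive_point) (auto simp: X_def point_def psl_act_one seed_def)
  then show ?thesis by simp
qed

theorem GT_iso:
  "PSL2C\<lparr>carrier := generate PSL2C {proj_PSL (Fmat T), proj_PSL (Gmat t)}\<rparr> \<cong> GT n Infty e"
proof -
  have "range (case_GT_gen a b) = {a, b}" for a b :: "mat2 set"
  proof -
    have U: "(UNIV :: GT_gen set) = {GTf, GTg}" by (auto intro: GT_gen.exhaust)
    show ?thesis by (simp only: U image_insert image_empty GT_gen.case)
  qed
  then show ?thesis using \<phi>.faithful_imp_iso faithful unfolding GT_presented by metis
qed

end

section \<open>The group Tet acting on chambers\<close>

text \<open>The half-turns \<open>AC: z \<mapsto> it - z\<close> and \<open>AB: z \<mapsto> -z\<close>.\<close>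

definition Xmat :: "real \<Rightarrow> mat2" where
  "Xmat t = mk2 \<i> t 0 (- \<i>)"

definition Ymat :: mat2 where
  "Ymat = mk2 \<i> 0 0 (- \<i>)"

lemma det_Xmat [simp]: "det (Xmat t) = 1"
  by (simp add: Xmat_def)

lemma det_Ymat [simp]: "det Ymat = 1"
  by (simp add: Ymat_def)

lemma inv_proj_X: "inv\<^bsub>PSL2C\<^esub> proj_PSL (Xmat t) = proj_PSL (mk2 (- \<i>) (- t) 0 \<i>)"
  unfolding Xmat_def by (subst proj_PSL_inv_mk2) simp_all

lemma inv_proj_Y: "inv\<^bsub>PSL2C\<^esub> proj_PSL Ymat = proj_PSL (mk2 (- \<i>) 0 0 \<i>)"
  unfolding Ymat_def by (subst proj_PSL_inv_mk2) simp_all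

lemma conjA_psl_X: "conjA (psl_act (proj_PSL (Xmat t)) Y) = psl_act (inv\<^bsub>PSL2C\<^esub> proj_PSL (Xmat t)) (conjA Y)"
proof -
  have "det (mk2 (- \<i>) (- t) 0 \<i>) = 1" by simp
  then show ?thesis unfolding inv_proj_X psl_act_proj[OF det_Xmat]
    by (subst psl_act_proj) (simp_all only: Xmat_def conjA_herm_act, simp)
qed

lemma conjA_psl_Y: "conjA (psl_act (proj_PSL Ymat) Y) = psl_act (inv\<^bsub>PSL2C\<^esub> proj_PSL Ymat) (conjA Y)"
proof -
  have "det (mk2 (- \<i>) 0 0 \<i>) = 1" by simp
  then show ?thesis unfolding inv_proj_Y psl_act_proj[OF det_Ymat]
    by (subst psl_act_proj) (simp_all only: Ymat_def conjA_herm_act, simp)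
qed

lemma conjA_X: "conjA (herm_act (Xmat t) Y) = herm_act (Gmat t) (conjB Y)"
  by (rule mk2_cases[of Y]) (simp add: conjA_def conjB_def herm_act_def conj_transpose_def Xmat_def Gmat_def algebra_simps)

lemma conjA_Y: "conjA (herm_act Ymat Y) = conjB Y"
  by (rule mk2_cases[of Y]) (simp add: conjA_def conjB_def herm_act_def conj_transpose_def Ymat_def algebra_simps)

definition Tet_relators :: "exponent \<Rightarrow> exponent \<Rightarrow> Tet_gen gword set" where
  "Tet_relators n q = pow_rel (gen Tetx) (Fin 2) \<union> pow_rel (gen Tety) (Fin 2) \<union> pow_rel (gen Tetz) n \<union>
     pow_rel (gen Tety @ winv (gen Tetz)) (Fin 2) \<union> pow_rel (gen Tetz @ winv (gen Tetx)) q"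

lemma Tet_presented: "Tet n Infty q = presented_group (Tet_relators n q)"
proof -
  have "{wpow (gen Tetx) 2, wpow (gen Tety) 2} \<union> pow_rel (gen Tetz) n \<union> {} \<union>
      {wpow (gen Tety @ winv (gen Tetz)) 2} \<union> pow_rel (gen Tetz @ winv (gen Tetx)) q = Tet_relators n q"
    by (auto simp: Tet_relators_def pow_rel_def)
  then show ?thesis by (simp add: Tet_def Let_def pow_rel_def[of _ Infty])
qed

lemma Tet_presented_homI:
  assumes "group H" "a \<in> carrier H" "b \<in> carrier H" "c \<in> carrier H"
    and "a [^]\<^bsub>H\<^esub> (2::int) = \<one>\<^bsub>H\<^esub>" "b [^]\<^bsub>H\<^esub> (2::int) = \<one>\<^bsub>H\<^esub>" "\<And>k. n = Fin k \<Longrightarrow> c [^]\<^bsub>H\<^esub> k = \<one>\<^bsub>H\<^esub>"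
    and "(b \<otimes>\<^bsub>H\<^esub> inv\<^bsub>H\<^esub> c) [^]\<^bsub>H\<^esub> (2::int) = \<one>\<^bsub>H\<^esub>"
    and "\<And>k. q = Fin k \<Longrightarrow> (c \<otimes>\<^bsub>H\<^esub> inv\<^bsub>H\<^esub> a) [^]\<^bsub>H\<^esub> k = \<one>\<^bsub>H\<^esub>"
  shows "presented_hom H (case_Tet_gen a b c) (Tet_relators n q)"
proof -
  interpret group_assignment H "case_Tet_gen a b c"
    using assms(1-4) by (intro group_assignment.intro group_assignment_axioms.intro)
      (auto split: Tet_gen.splits)
  show ?thesis
  proof
    fix r assume "r \<in> Tet_relators n q"
    then consider (x) "r \<in> pow_rel (gen Tetx) (Fin 2)" | (y) "r \<in> pow_rel (gen Tety) (Fin 2)"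
      | (z) "r \<in> pow_rel (gen Tetz) n" | (yz) "r \<in> pow_rel (gen Tety @ winv (gen Tetz)) (Fin 2)"
      | (zx) "r \<in> pow_rel (gen Tetz @ winv (gen Tetx)) q"
      unfolding Tet_relators_def by blast
    then show "eval_word H (case_Tet_gen a b c) r = \<one>\<^bsub>H\<^esub>"
    proof cases
      case x
      then show ?thesis by (rule pow_rel_trivial) (use assms(5) in auto)
    next
      case y
      then show ?thesis by (rule pow_rel_trivial) (use assms(6) in auto)
    next
      case z
      then show ?thesis by (rule pow_rel_trivial) (simp add: assms(7))
    next
      case yz
      then show ?thesis by (rule pow_rel_trivial) (use assms(8) in auto)
    next
      case zx
      then show ?thesis by (rule pow_rel_trivial) (simp add: assms(9))
    qed
  qed
qed

text \<open>The generators stand for \<open>x = AC\<close>, \<open>y = AB\<close> and \<open>z = AS\<close>: they generate the orientation preserving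
subgroup of the whole reflection group. Conjugation by \<open>A\<close> inverts each of them, so adjoining this one
involution already restores all mirrors.\<close>

locale Tet_rep = face_angles +
  fixes q :: exponent
  assumes angle_q: "angle_exponent q (t / 2)"
begin

abbreviation "R \<equiv> Tet_relators n q"
abbreviation "P \<equiv> presented_group R"
abbreviation "x \<equiv> pres_gen R Tetx"
abbreviation "y \<equiv> pres_gen R Tety"
abbreviation "z \<equiv> pres_gen R Tetz"

sublocale P: group_assignment P "pres_gen R" by (rule group_assignment_pres_gen)

lemma relations:
  "x [^]\<^bsub>P\<^esub> (2::int) = \<one>\<^bsub>P\<^esub>" "y [^]\<^bsub>P\<^esub> (2::int) = \<one>\<^bsub>P\<^esub>"
  "(y \<otimes>\<^bsub>P\<^esub> inv\<^bsub>P\<^esub> z) [^]\<^bsub>P\<^esub> (2::int) = \<one>\<^bsub>P\<^esub>"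
  "n = Fin k \<Longrightarrow> z [^]\<^bsub>P\<^esub> k = \<one>\<^bsub>P\<^esub>"
  "q = Fin k \<Longrightarrow> (z \<otimes>\<^bsub>P\<^esub> inv\<^bsub>P\<^esub> x) [^]\<^bsub>P\<^esub> k = \<one>\<^bsub>P\<^esub>"
proof -
  have "pow_rel (gen Tetx) (Fin 2) \<subseteq> R" by (auto simp: Tet_relators_def)
  from pow_rel_holds[OF this] show "x [^]\<^bsub>P\<^esub> (2::int) = \<one>\<^bsub>P\<^esub>" by simp
  have "pow_rel (gen Tety) (Fin 2) \<subseteq> R" by (auto simp: Tet_relators_def)
  from pow_rel_holds[OF this] show "y [^]\<^bsub>P\<^esub> (2::int) = \<one>\<^bsub>P\<^esub>" by simp
  have "pow_rel (gen Tety @ winv (gen Tetz)) (Fin 2) \<subseteq> R" by (auto simp: Tet_relators_def)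
  from pow_rel_holds[OF this] show "(y \<otimes>\<^bsub>P\<^esub> inv\<^bsub>P\<^esub> z) [^]\<^bsub>P\<^esub> (2::int) = \<one>\<^bsub>P\<^esub>" by simp
  show "z [^]\<^bsub>P\<^esub> k = \<one>\<^bsub>P\<^esub>" if "n = Fin k"
  proof -
    have "pow_rel (gen Tetz) (Fin k) \<subseteq> R" using that by (auto simp: Tet_relators_def)
    from pow_rel_holds[OF this] show ?thesis by simp
  qed
  show "(z \<otimes>\<^bsub>P\<^esub> inv\<^bsub>P\<^esub> x) [^]\<^bsub>P\<^esub> k = \<one>\<^bsub>P\<^esub>" if "q = Fin k"
  proof -
    have "pow_rel (gen Tetz @ winv (gen Tetx)) (Fin k) \<subseteq> R" using that by (auto simp: Tet_relators_def)
    from pow_rel_holds[OF this] show ?thesis by simp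
  qed
qed

text \<open>Inverting all three generators turns each relator into a conjugate of its inverse, so it defines an
automorphism of \<open>P\<close>.\<close>

lemma mirror_relations:
  "(inv\<^bsub>P\<^esub> y \<otimes>\<^bsub>P\<^esub> z) [^]\<^bsub>P\<^esub> (2::int) = \<one>\<^bsub>P\<^esub>"
  "q = Fin k \<Longrightarrow> (inv\<^bsub>P\<^esub> z \<otimes>\<^bsub>P\<^esub> x) [^]\<^bsub>P\<^esub> k = \<one>\<^bsub>P\<^esub>"
proof -
  show "(inv\<^bsub>P\<^esub> y \<otimes>\<^bsub>P\<^esub> z) [^]\<^bsub>P\<^esub> (2::int) = \<one>\<^bsub>P\<^esub>"
    using P.pow_conj_inv[OF _ _ relations(3), of "inv\<^bsub>P\<^esub> y"]
    by (simp add: P.inv_mult_group P.m_assoc)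
  show "(inv\<^bsub>P\<^esub> z \<otimes>\<^bsub>P\<^esub> x) [^]\<^bsub>P\<^esub> k = \<one>\<^bsub>P\<^esub>" if qk: "q = Fin k"
    using P.pow_conj_inv[OF _ _ relations(5)[OF qk], of "inv\<^bsub>P\<^esub> z"]
    by (simp add: P.inv_mult_group P.m_assoc)
qed

lemma psl_relations:
  "proj_PSL (Xmat t) [^]\<^bsub>PSL2C\<^esub> (2::int) = \<one>\<^bsub>PSL2C\<^esub>"
  "proj_PSL Ymat [^]\<^bsub>PSL2C\<^esub> (2::int) = \<one>\<^bsub>PSL2C\<^esub>"
  "(proj_PSL Ymat \<otimes>\<^bsub>PSL2C\<^esub> inv\<^bsub>PSL2C\<^esub> proj_PSL (Fmat T)) [^]\<^bsub>PSL2C\<^esub> (2::int) = \<one>\<^bsub>PSL2C\<^esub>"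
  "q = Fin k \<Longrightarrow> (proj_PSL (Fmat T) \<otimes>\<^bsub>PSL2C\<^esub> inv\<^bsub>PSL2C\<^esub> proj_PSL (Xmat t)) [^]\<^bsub>PSL2C\<^esub> k = \<one>\<^bsub>PSL2C\<^esub>"
proof -
  have half_turn: "proj_PSL A [^]\<^bsub>PSL2C\<^esub> (2::int) = \<one>\<^bsub>PSL2C\<^esub>" if "det A = 1" "trace A = 0" for A
    using psl_power_trivial_int[OF that(1), of 2] that(2) by simp
  show "proj_PSL (Xmat t) [^]\<^bsub>PSL2C\<^esub> (2::int) = \<one>\<^bsub>PSL2C\<^esub>"
    by (rule half_turn) (simp_all add: Xmat_def)
  show "proj_PSL Ymat [^]\<^bsub>PSL2C\<^esub> (2::int) = \<one>\<^bsub>PSL2C\<^esub>"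
    by (rule half_turn) (simp_all add: Ymat_def)
  define F' where "F' = mk2 (T / 2) (1 - complex_of_real (T\<^sup>2 / 4)) (- 1) (T / 2)"
  have F': "det F' = 1" "inv\<^bsub>PSL2C\<^esub> proj_PSL (Fmat T) = proj_PSL F'"
    by (simp_all add: F'_def inv_proj_F power2_eq_square)
  have "proj_PSL (Ymat ** F') [^]\<^bsub>PSL2C\<^esub> (2::int) = \<one>\<^bsub>PSL2C\<^esub>"
    by (rule half_turn) (simp_all add: det_mul F'(1), simp add: Ymat_def F'_def)
  then show "(proj_PSL Ymat \<otimes>\<^bsub>PSL2C\<^esub> inv\<^bsub>PSL2C\<^esub> proj_PSL (Fmat T)) [^]\<^bsub>PSL2C\<^esub> (2::int) = \<one>\<^bsub>PSL2C\<^esub>"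
    by (simp add: F' proj_PSL_mult)
  define X' where "X' = mk2 (- \<i>) (- t) 0 \<i>"
  have X': "det X' = 1" "inv\<^bsub>PSL2C\<^esub> proj_PSL (Xmat t) = proj_PSL X'"
    by (simp_all add: X'_def inv_proj_X)
  show "(proj_PSL (Fmat T) \<otimes>\<^bsub>PSL2C\<^esub> inv\<^bsub>PSL2C\<^esub> proj_PSL (Xmat t)) [^]\<^bsub>PSL2C\<^esub> k = \<one>\<^bsub>PSL2C\<^esub>"
    if qk: "q = Fin k"
  proof -
    obtain m where m: "m \<ge> 2" "k = int m" "t / 2 = cos (pi / real m)"
      using angle_exponent_Fin[OF angle_q qk] .
    have "t = 2 * cos (pi / real m)" using m(3) by simp
    moreover have "trace (Fmat T ** X') = - complex_of_real t"
      by (simp add: Fmat_def X'_def)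
    ultimately have tr: "trace (Fmat T ** X') = - complex_of_real (2 * cos (pi / real m))" by (simp only:)
    have "det (Fmat T ** X') = 1" by (simp add: det_mul X'(1))
    from psl_power_trivial_int[OF this m(1) disjI2[OF tr]]
    show ?thesis by (simp add: m(2) X' proj_PSL_mult)
  qed
qed

lemma presented_hom_psl:
  "presented_hom PSL2C (case_Tet_gen (proj_PSL (Xmat t)) (proj_PSL Ymat) (proj_PSL (Fmat T))) R"
  by (rule Tet_presented_homI[OF group_PSL2C])
    (simp_all only: proj_PSL_closed det_Fmat det_Xmat det_Ymat F_power psl_relations)

lemma presented_hom_\<sigma>: "presented_hom P (case_Tet_gen (inv\<^bsub>P\<^esub> x) (inv\<^bsub>P\<^esub> y) (inv\<^bsub>P\<^esub> z)) R"
proof (rule Tet_presented_homI)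
  show "inv\<^bsub>P\<^esub> x [^]\<^bsub>P\<^esub> (2::int) = \<one>\<^bsub>P\<^esub>" "inv\<^bsub>P\<^esub> y [^]\<^bsub>P\<^esub> (2::int) = \<one>\<^bsub>P\<^esub>"
    using relations by (simp_all add: P.int_pow_inv)
  show "inv\<^bsub>P\<^esub> z [^]\<^bsub>P\<^esub> k = \<one>\<^bsub>P\<^esub>" if "n = Fin k" for k
    using relations(4)[OF that] by (simp add: P.int_pow_inv)
  show "(inv\<^bsub>P\<^esub> y \<otimes>\<^bsub>P\<^esub> inv\<^bsub>P\<^esub> (inv\<^bsub>P\<^esub> z)) [^]\<^bsub>P\<^esub> (2::int) = \<one>\<^bsub>P\<^esub>"
    using mirror_relations(1) by simp
  show "(inv\<^bsub>P\<^esub> z \<otimes>\<^bsub>P\<^esub> inv\<^bsub>P\<^esub> (inv\<^bsub>P\<^esub> x)) [^]\<^bsub>P\<^esub> k = \<one>\<^bsub>P\<^esub>" if "q = Fin k" for k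
    using mirror_relations(2)[OF that] by simp
qed (simp_all add: P.is_group)

sublocale \<phi>: presented_hom PSL2C "case_Tet_gen (proj_PSL (Xmat t)) (proj_PSL Ymat) (proj_PSL (Fmat T))" R
  by (rule presented_hom_psl)

sublocale \<sigma>: presented_hom P "case_Tet_gen (inv\<^bsub>P\<^esub> x) (inv\<^bsub>P\<^esub> y) (inv\<^bsub>P\<^esub> z)" R
  by (rule presented_hom_\<sigma>)

abbreviation "\<phi> \<equiv> \<phi>.induced"
abbreviation "\<sigma> \<equiv> \<sigma>.induced"

lemma \<sigma>_\<sigma>: "p \<in> carrier P \<Longrightarrow> \<sigma> (\<sigma> p) = p"
  by (induction rule: presented_group_induct) (auto split: Tet_gen.splits)

definition point :: "Tet_gen gword set \<times> bool \<Rightarrow> mat2" where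
  "point w = psl_act (\<phi> (fst w)) ((if snd w then conjA else id) (chamber_point T t))"

definition X :: "(Tet_gen gword set \<times> bool) set" where
  "X = carrier P \<times> UNIV"

text \<open>The element of \<open>P\<close> that stands for the product of \<open>A\<close> with the given mirror.\<close>

fun rotation :: "face \<Rightarrow> Tet_gen gword set" where
  "rotation FA = \<one>\<^bsub>P\<^esub>"
| "rotation FS = z"
| "rotation FB = y"
| "rotation FC = x"

text \<open>Left multiplication by the mirror \<open>A \<cdot> rotation i\<close>, where \<open>(p, a)\<close> stands for \<open>p A\<^sup>a\<close>.\<close>

definition refl :: "face \<Rightarrow> Tet_gen gword set \<times> bool \<Rightarrow> Tet_gen gword set \<times> bool" where
  "refl i w = (\<sigma> (rotation i \<otimes>\<^bsub>P\<^esub> fst w), \<not> snd w)"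

lemma rotation_closed [simp]: "rotation i \<in> carrier P"
  by (cases i) simp_all

lemma \<sigma>_rotation: "\<sigma> (rotation i) = inv\<^bsub>P\<^esub> rotation i"
  by (cases i) simp_all

lemma refl_refl:
  assumes "w \<in> X"
  shows "refl i (refl j w) = (inv\<^bsub>P\<^esub> rotation i \<otimes>\<^bsub>P\<^esub> (rotation j \<otimes>\<^bsub>P\<^esub> fst w), snd w)"
  using assms by (auto simp: refl_def X_def \<sigma>_rotation \<sigma>_\<sigma>)

lemma conjA_psl_act:
  assumes "p \<in> carrier P"
  shows "conjA (psl_act (\<phi> p) Y) = psl_act (\<phi> (\<sigma> p)) (conjA Y)"
proof (rule intertwine[OF \<phi>.group_hom_induced \<sigma>.group_hom_induced _ assms])
  fix g Y
  show "conjA (psl_act (\<phi> (pres_gen R g)) Y) = psl_act (\<phi> (\<sigma> (pres_gen R g))) (conjA Y)"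
    by (cases g) (simp_all add: conjA_psl_F conjA_psl_X conjA_psl_Y)
qed

lemma point_refl:
  assumes "w \<in> X"
  shows "point (refl i w) = face_refl T t i (point w)"
proof -
  obtain p a where w: "w = (p, a)" "p \<in> carrier P" using assms by (auto simp: X_def)
  define Y where "Y = (if a then conjA else id) (chamber_point T t)"
  have Y: "(if \<not> a then conjA else id) (chamber_point T t) = conjA Y" by (simp add: Y_def)
  have "point (refl i w) = psl_act (\<phi> (\<sigma> (rotation i \<otimes>\<^bsub>P\<^esub> p))) (conjA Y)"
    by (simp only: point_def refl_def w fst_conv snd_conv Y)
  also have "\<dots> = conjA (psl_act (\<phi> (rotation i \<otimes>\<^bsub>P\<^esub> p)) Y)"
    using w by (simp only: conjA_psl_act rotation_closed P.m_closed)
  also have "\<dots> = conjA (psl_act (\<phi> (rotation i)) (point w))"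
    using w by (simp add: psl_act_mult point_def Y_def)
  also have "\<dots> = face_refl T t i (point w)"
    by (cases i) (simp_all add: psl_act_one psl_act_proj conjA_X conjA_Y)
  finally show ?thesis .
qed

lemma refl_closed: "w \<in> X \<Longrightarrow> refl i w \<in> X"
  by (auto simp: X_def refl_def)

lemma refl_invol: "w \<in> X \<Longrightarrow> refl i (refl i w) = w"
  by (auto simp: refl_refl X_def)

lemma refl_reach:
  assumes "w \<in> X"
  shows "\<exists>u. foldr refl u (\<one>\<^bsub>P\<^esub>, False) = w"
proof -
  define Q where "Q = {w. \<exists>u. foldr refl u (\<one>\<^bsub>P\<^esub>, False) = w}"
  have step: "refl i w \<in> Q" if wQ: "w \<in> Q" for i w
  proof -
    obtain u where "foldr refl u (\<one>\<^bsub>P\<^esub>, False) = w" using wQ by (auto simp: Q_def)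
    then have "foldr refl (i # u) (\<one>\<^bsub>P\<^esub>, False) = refl i w" by simp
    then show ?thesis unfolding Q_def by blast
  qed
  have base: "(\<one>\<^bsub>P\<^esub>, a) \<in> Q" for a
  proof -
    have 0: "(\<one>\<^bsub>P\<^esub>, False) \<in> Q" unfolding Q_def by (auto intro: exI[of _ "[]"])
    show ?thesis using 0 step[OF 0, of FA] by (cases a) (simp_all add: refl_def)
  qed
  have face: "\<exists>i. pres_gen R g = rotation i" for g
    by (cases g) (metis rotation.simps)+
  have "(p, a) \<in> Q" if p: "p \<in> carrier P" for p a
    using p
  proof (induction rule: presented_group_induct)
    case one
    show ?case by (rule base)
  next
    case (mult g p)
    obtain i where i: "pres_gen R g = rotation i" using face by blast
    have "refl FA (refl i (p, a)) = (rotation i \<otimes>\<^bsub>P\<^esub> p, a)"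
      using mult(1) refl_refl[of "(p, a)" FA i] by (simp add: X_def)
    then show ?case using step[OF step[OF mult(2)]] i by metis
  next
    case (inv g p)
    obtain i where i: "pres_gen R g = rotation i" using face by blast
    have "refl i (refl FA (p, a)) = (inv\<^bsub>P\<^esub> rotation i \<otimes>\<^bsub>P\<^esub> p, a)"
      using inv(1) refl_refl[of "(p, a)" i FA] by (simp add: X_def)
    then show ?case using step[OF step[OF inv(2)]] i by metis
  qed
  then have "w \<in> Q" using assms by (cases w) (auto simp: X_def)
  then show ?thesis by (simp add: Q_def)
qed

text \<open>A product of two mirrors is left multiplication by an element of \<open>P\<close>, so its order can be read off the relators.\<close>

lemma dihedral_pair_rotation:
  assumes e: "angle_exponent e c"
    and pow: "\<And>k. e = Fin k \<Longrightarrow> (inv\<^bsub>P\<^esub> rotation i \<otimes>\<^bsub>P\<^esub> rotation j) [^]\<^bsub>P\<^esub> k = \<one>\<^bsub>P\<^esub>"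
  shows "dihedral_pair X refl c i j"
proof (cases "c \<ge> 1")
  case False
  then obtain m where m: "m \<ge> 2" "e = Fin (int m)" "c = cos (pi / real m)"
    using e by (auto simp: angle_exponent_def)
  let ?u = "inv\<^bsub>P\<^esub> rotation i \<otimes>\<^bsub>P\<^esub> rotation j"
  have u: "?u \<in> carrier P" by simp
  have iter: "((refl i \<circ> refl j) ^^ k) (p, a) = (?u [^]\<^bsub>P\<^esub> k \<otimes>\<^bsub>P\<^esub> p, a)"
    if p: "p \<in> carrier P" for p a k
  proof (induction k)
    case (Suc k)
    have "?u [^]\<^bsub>P\<^esub> Suc k \<otimes>\<^bsub>P\<^esub> p = ?u \<otimes>\<^bsub>P\<^esub> (?u [^]\<^bsub>P\<^esub> k \<otimes>\<^bsub>P\<^esub> p)"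
      using p by (simp only: P.nat_pow_Suc2[OF u] P.m_assoc[OF u P.nat_pow_closed[OF u] p])
    moreover have "(refl i \<circ> refl j) (s, a) = (?u \<otimes>\<^bsub>P\<^esub> s, a)" if s: "s \<in> carrier P" for s
      using s refl_refl[of "(s, a)" i j] by (simp add: X_def P.m_assoc)
    ultimately show ?case using Suc p u by (simp del: P.nat_pow_Suc)
  qed (use p in simp)
  have "((refl i \<circ> refl j) ^^ m) w = w" if w: "w \<in> X" for w
  proof -
    obtain p a where "w = (p, a)" "p \<in> carrier P" using w by (auto simp: X_def)
    then show ?thesis using iter[of p m a] pow[OF m(2)] by (simp add: int_pow_int)
  qed
  then show ?thesis unfolding dihedral_pair_def using m by blast
qed (simp add: dihedral_pair_def)

lemma right_angle: "angle_exponent (Fin 2) 0"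
  unfolding angle_exponent_def by (rule disjI1, rule exI[of _ 2]) simp

lemma pairs:
  "dihedral_pair X refl 0 FA FB" "dihedral_pair X refl 0 FA FC" "dihedral_pair X refl 0 FB FS"
  "dihedral_pair X refl (T / 2) FA FS" "dihedral_pair X refl (t / 2) FS FC" "dihedral_pair X refl 1 FB FC"
proof -
  show "dihedral_pair X refl 0 FA FB"
    by (rule dihedral_pair_rotation[OF right_angle]) (use relations(2) in auto)
  show "dihedral_pair X refl 0 FA FC"
    by (rule dihedral_pair_rotation[OF right_angle]) (use relations(1) in auto)
  show "dihedral_pair X refl 0 FB FS"
    by (rule dihedral_pair_rotation[OF right_angle]) (use mirror_relations(1) in auto)
  show "dihedral_pair X refl (T / 2) FA FS"
  proof (rule dihedral_pair_rotation[OF angle_n])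
    show "(inv\<^bsub>P\<^esub> rotation FA \<otimes>\<^bsub>P\<^esub> rotation FS) [^]\<^bsub>P\<^esub> k = \<one>\<^bsub>P\<^esub>" if "n = Fin k" for k
      using relations(4)[OF that] by simp
  qed
  show "dihedral_pair X refl (t / 2) FS FC"
  proof (rule dihedral_pair_rotation[OF angle_q])
    show "(inv\<^bsub>P\<^esub> rotation FS \<otimes>\<^bsub>P\<^esub> rotation FC) [^]\<^bsub>P\<^esub> k = \<one>\<^bsub>P\<^esub>" if "q = Fin k" for k
      using mirror_relations(2)[OF that] by simp
  qed
  show "dihedral_pair X refl 1 FB FC"
    by (simp add: dihedral_pair_def)
qed

sublocale reflection_set X refl "(\<one>\<^bsub>P\<^esub>, False)" "\<lambda>i w. face_form T t i (point w)" "face_cos T t"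
proof
  fix i j :: face
  show "i \<noteq> j \<Longrightarrow> dihedral_pair X refl (face_cos T t i j) i j \<or> dihedral_pair X refl (face_cos T t i j) j i"
    using pairs by (cases i; cases j) simp_all
  show "face_cos T t i j = face_cos T t j i" by (cases i; cases j) simp_all
  show "face_form T t i (point (\<one>\<^bsub>P\<^esub>, False)) > 0"
    using chamber_point_pos[OF T_nonneg t_pos] by (simp add: point_def psl_act_one)
qed (auto simp: refl_closed refl_invol refl_reach point_refl face_form_same face_form_other, simp add: X_def)

lemma faithful:
  assumes "p \<in> carrier P" "\<phi> p = \<one>\<^bsub>PSL2C\<^esub>"
  shows "p = \<one>\<^bsub>P\<^esub>"
proof -
  have "(p, False) = (\<one>\<^bsub>P\<^esub>, False)"
    using assms chamber_point_pos[OF T_nonneg t_pos]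
    by (intro base_only_positive_point) (auto simp: X_def point_def psl_act_one)
  then show ?thesis by simp
qed

theorem Tet_iso:
  "PSL2C\<lparr>carrier := generate PSL2C {proj_PSL (Xmat t), proj_PSL Ymat, proj_PSL (Fmat T)}\<rparr> \<cong> Tet n Infty q"
proof -
  have "range (case_Tet_gen a b c) = {a, b, c}" for a b c :: "mat2 set"
  proof -
    have U: "(UNIV :: Tet_gen set) = {Tetx, Tety, Tetz}" by (auto intro: Tet_gen.exhaust)
    show ?thesis by (simp only: U image_insert image_empty Tet_gen.case)
  qed
  then show ?thesis using \<phi>.faithful_imp_iso faithful unfolding Tet_presented by metis
qed

end

text \<open>Put \<open>m = f\<^sup>-\<^sup>1 x\<close> and \<open>g = x y\<close>. Since \<open>y f y = f\<^sup>-\<^sup>1\<close>, the element \<open>m\<^sup>2\<close> equals \<open>f\<^sup>-\<^sup>1 g f g\<^sup>-\<^sup>1\<close> and lies in the group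
generated by \<open>f\<close> and \<open>g\<close>. As the order of \<open>m\<close> divides \<open>2k + 1\<close>, the \<open>(k + 1)\<close>-st power of \<open>m\<^sup>2\<close> is \<open>m\<close>.
Hence \<open>x = f m\<close> and \<open>y = x g\<close> are generated too.\<close>

lemma (in group) half_turns_generated:
  assumes c: "f \<in> carrier G" "x \<in> carrier G" "y \<in> carrier G"
    and x: "x \<otimes> x = \<one>" and y: "y \<otimes> y = \<one>" and yf: "y \<otimes> (f \<otimes> y) = inv f"
    and pow: "(inv f \<otimes> x) [^] (2 * k + 1 :: nat) = \<one>"
  shows "generate G {f, x \<otimes> y} = generate G {x, y, f}"
proof (rule equalityI; rule generate_subgroup_incl)
  let ?H = "generate G {f, x \<otimes> y}"
  show H: "subgroup ?H G" "subgroup (generate G {x, y, f}) G"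
    using c by (auto intro!: generate_is_subgroup)
  show "{f, x \<otimes> y} \<subseteq> generate G {x, y, f}"
    by (auto intro: generate.incl generate.eng)
  have inv: "inv x = x" "inv y = y" using c x y inv_equality by blast+
  let ?m = "inv f \<otimes> x"
  have m: "?m \<in> carrier G" using c by simp
  have f: "f \<in> ?H" "x \<otimes> y \<in> ?H" by (auto intro: generate.incl)
  have "inv f \<otimes> ((x \<otimes> y) \<otimes> (f \<otimes> inv (x \<otimes> y))) = inv f \<otimes> (x \<otimes> ((y \<otimes> (f \<otimes> y)) \<otimes> x))"
    using c by (simp add: inv_mult_group inv m_assoc)
  also have "\<dots> = ?m \<otimes> ?m" unfolding yf using c by (simp add: m_assoc)
  finally have mm: "?m \<otimes> ?m \<in> ?H"
    using f H(1) by (metis subgroup.m_closed subgroup.m_inv_closed)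
  have "(?m \<otimes> ?m) [^] j \<in> ?H" for j :: nat
    by (induction j) (use mm H(1) in \<open>simp_all add: subgroup.one_closed subgroup.m_closed\<close>)
  moreover have "(?m \<otimes> ?m) [^] Suc k = ?m [^] (2 * Suc k)"
  proof -
    have "?m \<otimes> ?m = ?m [^] (2::nat)" using m by (simp add: numeral_2_eq_2)
    then show ?thesis using m by (simp only: nat_pow_pow)
  qed
  moreover have "?m [^] (2 * Suc k) = ?m"
  proof -
    have "2 * Suc k = (2 * k + 1) + 1" by simp
    then have "?m [^] (2 * Suc k) = ?m [^] (2 * k + 1) \<otimes> ?m [^] (1::nat)"
      using nat_pow_mult[OF m, of "2 * k + 1" 1] by metis
    then show ?thesis using m pow by simp
  qed
  ultimately have "?m \<in> ?H" by metis
  then have "f \<otimes> ?m \<in> ?H" using f(1) H(1) subgroup.m_closed by metis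
  moreover have "f \<otimes> ?m = x" using c by simp
  ultimately have xH: "x \<in> ?H" by simp
  have "x \<otimes> (x \<otimes> y) = y" using c x by (simp flip: m_assoc)
  then have "y \<in> ?H" using xH f(2) H(1) subgroup.m_closed by metis
  with xH f(1) show "{x, y, f} \<subseteq> ?H" by blast
qed

lemma (in Tet_rep) Tet_iso_odd:
  assumes q: "q = Fin (int (2 * k + 1))"
  shows "PSL2C\<lparr>carrier := generate PSL2C {proj_PSL (Fmat T), proj_PSL (Gmat t)}\<rparr> \<cong> Tet n Infty q"
proof -
  let ?x = "proj_PSL (Xmat t)" and ?y = "proj_PSL Ymat" and ?f = "proj_PSL (Fmat T)"
  have c: "?x \<in> carrier PSL2C" "?y \<in> carrier PSL2C" "?f \<in> carrier PSL2C" by simp_all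
  have "Xmat t ** Ymat = - Gmat t" by (simp add: Xmat_def Ymat_def Gmat_def)
  then have xy: "?x \<otimes>\<^bsub>PSL2C\<^esub> ?y = proj_PSL (Gmat t)" by (simp add: proj_PSL_mult proj_PSL_uminus)
  have "Xmat t ** Xmat t = - mat 1" "Ymat ** Ymat = - mat 1"
    by (simp_all add: Xmat_def Ymat_def one_mk2)
  then have sq: "?x \<otimes>\<^bsub>PSL2C\<^esub> ?x = \<one>\<^bsub>PSL2C\<^esub>" "?y \<otimes>\<^bsub>PSL2C\<^esub> ?y = \<one>\<^bsub>PSL2C\<^esub>"
    by (simp_all add: proj_PSL_mult proj_PSL_uminus proj_PSL_one)
  have "Ymat ** (Fmat T ** Ymat) = - mk2 (T / 2) (1 - complex_of_real (T\<^sup>2 / 4)) (- 1) (T / 2)"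
    by (simp add: Ymat_def Fmat_def algebra_simps)
  then have yfy: "?y \<otimes>\<^bsub>PSL2C\<^esub> (?f \<otimes>\<^bsub>PSL2C\<^esub> ?y) = inv\<^bsub>PSL2C\<^esub> ?f"
    by (simp add: proj_PSL_mult det_mul proj_PSL_uminus inv_proj_F del: uminus_mk2)
  have "(inv\<^bsub>PSL2C\<^esub> ?f \<otimes>\<^bsub>PSL2C\<^esub> ?x) [^]\<^bsub>PSL2C\<^esub> int (2 * k + 1) = \<one>\<^bsub>PSL2C\<^esub>"
    using group.pow_conj_inv[OF group_PSL2C, OF _ _ psl_relations(4)[OF q], of "inv\<^bsub>PSL2C\<^esub> ?f"] c
    by (simp add: proj.H.inv_mult_group proj.H.m_assoc del: of_nat_add of_nat_mult)
  then have "(inv\<^bsub>PSL2C\<^esub> ?f \<otimes>\<^bsub>PSL2C\<^esub> ?x) [^]\<^bsub>PSL2C\<^esub> (2 * k + 1) = \<one>\<^bsub>PSL2C\<^esub>"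
    by (simp only: int_pow_int)
  from group.half_turns_generated[OF group_PSL2C, OF c(3,1,2) sq yfy this]
  show ?thesis using Tet_iso unfolding xy by simp
qed

section \<open>Conjugation of the generators to a normal form\<close>

text \<open>Write \<open>A\<close> and \<open>B\<close> for the two given matrices and \<open>B = 1 + E\<close> with \<open>E\<^sup>2 = 0\<close>. The first column of \<open>N\<close> is a
kernel vector \<open>v\<close> of \<open>E\<close> and the second is \<open>A v - (T/2) v\<close>; the shape of \<open>N\<^sup>-\<^sup>1 A N\<close> is then Cayley--Hamilton. Moreover
\<open>E\<close> maps the second column to \<open>K v\<close> with \<open>K = tr (A E)\<close>, and \<open>tr [A, B] - 2 = K\<^sup>2\<close>, so \<open>K = \<plusminus>it\<close>. The
hypotheses determine only \<open>K\<^sup>2\<close>, which is why \<open>t\<close> and \<open>-t\<close> both occur.\<close>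

lemma parabolic_normal_form:
  fixes a b c d p q r s :: complex and T t :: real
  assumes det: "a * d - b * c = 1" "p * s - q * r = 1" and tr: "a + d = T" "p + s = 2"
    and gam: "trace (mk2 a b c d ** mk2 p q r s ** mk2 d (- b) (- c) a ** mk2 s (- q) (- r) p) - 2
      = - (complex_of_real t)\<^sup>2" and t: "t \<noteq> 0"
  shows "\<exists>N. det N = 1 \<and> mk2 a b c d ** N = N ** Fmat T \<and>
    (mk2 p q r s ** N = N ** Gmat t \<or> mk2 p q r s ** N = N ** Gmat (- t))"
proof -
  define u where "u = p - 1"
  \<comment> \<open>The trace of the first matrix times \<open>E\<close>, where \<open>E\<close> has the rows \<open>(u, q)\<close> and \<open>(r, -u)\<close>.\<close>
  define K where "K = c * q + (a - d) * u + b * r"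
  have p: "p = 1 + u" and s: "s = 1 - u" using tr(2) by (simp_all add: u_def algebra_simps)
  have nil: "u * u + q * r = 0" using det(2) unfolding p s by (simp add: algebra_simps)
  have "K * K = trace (mk2 a b c d ** mk2 p q r s ** mk2 d (- b) (- c) a ** mk2 s (- q) (- r) p) - 2"
    unfolding K_def p s mk2_mult trace_mk2 using det(1) nil by algebra
  then have KK: "K * K = - (complex_of_real t * complex_of_real t)"
    using gam by (simp add: power2_eq_square)
  then have K0: "K \<noteq> 0" using t by auto
  have "(K - \<i> * t) * (K + \<i> * t) = 0" using KK by (simp add: algebra_simps)
  then have K: "K = \<i> * complex_of_real t \<or> K = \<i> * complex_of_real (- t)"
    by (auto simp: eq_neg_iff_add_eq_0)
  \<comment> \<open>The kernel vector is a nonzero column of \<open>E\<close>. The third condition says that it is not an eigenvector of the first matrix.\<close>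
  have "\<exists>x y. u * x + q * y = 0 \<and> r * x - u * y = 0 \<and> c * x * x + (d - a) * x * y - b * y * y \<noteq> 0 \<and>
     u * (a * x + b * y) + q * (c * x + d * y) = K * x \<and> r * (a * x + b * y) - u * (c * x + d * y) = K * y"
  proof (cases "q = 0")
    case False
    have "c * q * q + (d - a) * q * (- u) - b * (- u) * (- u) = q * K"
      unfolding K_def using nil by algebra
    moreover have "u * (a * q + b * (- u)) + q * (c * q + d * (- u)) = K * q"
      "r * (a * q + b * (- u)) - u * (c * q + d * (- u)) = K * (- u)"
      unfolding K_def using nil by algebra+
    moreover have "r * q - u * (- u) = 0" using nil by (simp add: algebra_simps)
    ultimately show ?thesis using False K0 by (intro exI[of _ q] exI[of _ "- u"]) auto
  next
    case True
    then have "u = 0" using nil by simp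
    then have "r \<noteq> 0" using K0 True by (auto simp: K_def)
    have "c * u * u + (d - a) * u * r - b * r * r = - (r * K)"
      unfolding K_def using nil by algebra
    moreover have "u * (a * u + b * r) + q * (c * u + d * r) = K * u"
      "r * (a * u + b * r) - u * (c * u + d * r) = K * r"
      unfolding K_def using nil by algebra+
    moreover have "u * u + q * r = 0" by (rule nil)
    ultimately show ?thesis using \<open>r \<noteq> 0\<close> K0 by (intro exI[of _ u] exI[of _ r]) auto
  qed
  then obtain x y where xy: "u * x + q * y = 0" "r * x - u * y = 0"
    and D0: "c * x * x + (d - a) * x * y - b * y * y \<noteq> 0"
    and E: "u * (a * x + b * y) + q * (c * x + d * y) = K * x"
      "r * (a * x + b * y) - u * (c * x + d * y) = K * y"
    by blast
  define D where "D = c * x * x + (d - a) * x * y - b * y * y"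
  \<comment> \<open>Rescaling the columns of \<open>N\<close> by \<open>l\<close> makes its determinant 1.\<close>
  define l where "l = inverse (csqrt D)"
  have "l * l = inverse D"
    unfolding l_def by (metis inverse_mult_distrib power2_csqrt power2_eq_square)
  then have lD: "l * l * D = 1" using D0 by (simp add: D_def)
  define h where "h = complex_of_real (T / 2)"
  have ad: "a + d = 2 * h" using tr(1) by (simp add: h_def)
  define x' where "x' = a * x + b * y - h * x"
  define y' where "y' = c * x + d * y - h * y"
  define N where "N = mk2 (l * x) (l * x') (l * y) (l * y')"
  have "det N = l * l * D" by (simp add: N_def x'_def y'_def D_def algebra_simps)
  then have 1: "det N = 1" by (simp add: lD)
  have F: "Fmat T = mk2 h (h * h - 1) 1 h" by (simp add: Fmat_def h_def power2_eq_square)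
  have "a * x' + b * y' = x * (h * h - 1) + x' * h" "c * x' + d * y' = y * (h * h - 1) + y' * h"
    unfolding x'_def y'_def using det(1) ad by algebra+
  then have eq: "l * (a * x' + b * y') = l * (x * (h * h - 1) + x' * h)"
    "l * (c * x' + d * y') = l * (y * (h * h - 1) + y' * h)" by simp_all
  then have 2: "mk2 a b c d ** N = N ** Fmat T"
    unfolding F N_def by (simp add: x'_def y'_def algebra_simps)
  have "p * x' + q * y' = x' + K * x" "r * x' + s * y' = y' + K * y"
    "p * x + q * y = x" "r * x + s * y = y"
    unfolding p s x'_def y'_def using E xy by algebra+
  then have "l * (p * x' + q * y') = l * (x' + K * x)" "l * (r * x' + s * y') = l * (y' + K * y)"
    "l * (p * x + q * y) = l * x" "l * (r * x + s * y) = l * y" by simp_all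
  then have 3: "mk2 p q r s ** N = N ** mk2 1 K 0 1"
    unfolding N_def by (simp add: algebra_simps)
  show ?thesis using 1 2 3 K unfolding Gmat_def by (intro exI[of _ N]) auto
qed

lemma (in group) conj_generate_iso:
  assumes x: "x \<in> carrier G" and K: "K \<subseteq> carrier G"
  shows "G\<lparr>carrier := generate G K\<rparr> \<cong> G\<lparr>carrier := generate G ((\<lambda>h. x \<otimes> h \<otimes> inv x) ` K)\<rparr>"
proof -
  let ?c = "\<lambda>h. x \<otimes> h \<otimes> inv x"
  have cancel: "inv x \<otimes> (x \<otimes> z) = z" if "z \<in> carrier G" for z
    using x that by (simp add: m_assoc[symmetric])
  have hom: "?c \<in> hom G G"
    by (rule homI) (use x cancel in \<open>simp_all add: m_assoc\<close>)
  interpret c: group_hom G G ?c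
    by (intro group_hom.intro group_hom_axioms.intro is_group hom)
  have "inj_on ?c (carrier G)"
    by (rule inj_onI) (use x in simp)
  then have inj: "inj_on ?c (generate G K)"
    using generate_incl[OF K] by (rule inj_on_subset)
  have mult: "?c (h \<otimes> k) = ?c h \<otimes> ?c k" if "h \<in> generate G K" "k \<in> generate G K" for h k
    using that generate_incl[OF K] by (intro c.hom_mult) auto
  have "?c \<in> iso (G\<lparr>carrier := generate G K\<rparr>) (G\<lparr>carrier := generate G (?c ` K)\<rparr>)"
    using inj mult c.generate_img[OF K] by (auto simp: iso_def hom_def bij_betw_def)
  then show ?thesis by (rule is_isoI)
qed

lemma (in group) generate_inv_generator:
  assumes "f \<in> carrier G" "g \<in> carrier G"
  shows "generate G {f, inv g} = generate G {f, g}"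
proof (rule equalityI; rule generate_subgroup_incl)
  show "subgroup (generate G {f, g}) G" "subgroup (generate G {f, inv g}) G"
    using assms by (auto intro: generate_is_subgroup)
  show "{f, inv g} \<subseteq> generate G {f, g}"
    by (auto intro: generate.incl generate.inv)
  have "inv (inv g) \<in> generate G {f, inv g}" by (rule generate.inv) simp
  then show "{f, g} \<subseteq> generate G {f, inv g}" using assms by (auto intro: generate.incl)
qed

text \<open>The two signs of \<open>t\<close> are exchanged by inverting \<open>g\<close>, which does not change the group generated.\<close>

lemma generate_iso_normal_form:
  assumes fg: "f \<in> carrier PSL2C" "g \<in> carrier PSL2C"
    and bf: "beta f = complex_of_real (T\<^sup>2 - 4)" and bg: "beta g = 0"
    and gam: "gamma f g = - complex_of_real (t\<^sup>2)" and t: "t \<noteq> 0"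
  shows "PSL2C\<lparr>carrier := generate PSL2C {f, g}\<rparr> \<cong>
    PSL2C\<lparr>carrier := generate PSL2C {proj_PSL (Fmat T), proj_PSL (Gmat t)}\<rparr>"
proof -
  have lifted: "\<exists>A. det A = 1 \<and> h = proj_PSL A \<and> A \<in> h \<and> trace A = complex_of_real S"
    if h: "h \<in> carrier PSL2C" "beta h = complex_of_real (S\<^sup>2 - 4)" for h S
  proof -
    obtain A where A: "det A = 1" "h = proj_PSL A" using PSL2C_cases[OF h(1)] .
    have mem: "A \<in> h" "- A \<in> h" by (simp_all add: A proj_PSL_eq)
    have "(trace A)\<^sup>2 = (complex_of_real S)\<^sup>2"
      using beta_lift_indep[OF h(1) mem(1)] h(2) by simp
    then have "trace A = S \<or> trace (- A) = S" by (auto simp: power2_eq_iff trace_uminus2)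
    then show ?thesis using A mem by (metis det_uminus2 proj_PSL_uminus)
  qed
  obtain A where A: "det A = 1" "f = proj_PSL A" "A \<in> f" "trace A = complex_of_real T"
    using lifted[OF fg(1) bf] by blast
  have "beta g = complex_of_real (2\<^sup>2 - 4)" using bg by simp
  then obtain B where B: "det B = 1" "g = proj_PSL B" "B \<in> g" "trace B = complex_of_real 2"
    using lifted[OF fg(2)] by blast
  obtain a b c d where a: "A = mk2 a b c d" by (rule mk2_cases)
  obtain p q r s where p: "B = mk2 p q r s" by (rule mk2_cases)
  have dets: "a * d - b * c = 1" "p * s - q * r = 1" using A B by (simp_all add: a p)
  have "trace (mk2 a b c d ** mk2 p q r s ** mk2 d (- b) (- c) a ** mk2 s (- q) (- r) p) - 2 =
      - (complex_of_real t)\<^sup>2"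
    using gamma_lift_indep[OF fg(1) A(3) fg(2) B(3)] gam
    by (simp only: a p inv_SL2C_mk2[OF dets(1)] inv_SL2C_mk2[OF dets(2)] SL2C_simps of_real_power)
  from parabolic_normal_form[OF dets _ _ this t, of T] A(4) B(4)
  obtain N where N: "det N = 1" "A ** N = N ** Fmat T" "B ** N = N ** Gmat t \<or> B ** N = N ** Gmat (- t)"
    by (auto simp: a p)
  let ?n = "proj_PSL N"
  have conj: "proj_PSL C = ?n \<otimes>\<^bsub>PSL2C\<^esub> proj_PSL C' \<otimes>\<^bsub>PSL2C\<^esub> inv\<^bsub>PSL2C\<^esub> ?n"
    if "C ** N = N ** C'" "det C = 1" "det C' = 1" for C C'
  proof -
    have c: "?n \<in> carrier PSL2C" "proj_PSL C \<in> carrier PSL2C" using that N(1) by simp_all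
    have eq: "?n \<otimes>\<^bsub>PSL2C\<^esub> proj_PSL C' = proj_PSL C \<otimes>\<^bsub>PSL2C\<^esub> ?n"
      by (simp only: that N(1) proj_PSL_mult)
    show ?thesis
      unfolding eq by (simp only: proj.H.m_assoc proj.H.inv_closed proj.H.r_inv proj.H.r_one c)
  qed
  have iG: "proj_PSL (Gmat (- t)) = inv\<^bsub>PSL2C\<^esub> proj_PSL (Gmat t)"
    unfolding Gmat_def by (subst proj_PSL_inv_mk2) simp_all
  have gen: "generate PSL2C {proj_PSL (Fmat T), proj_PSL (Gmat t')} =
      generate PSL2C {proj_PSL (Fmat T), proj_PSL (Gmat t)}" if "t' = t \<or> t' = - t" for t'
    using that
  proof
    assume "t' = - t"
    then show ?thesis
      by (simp only: iG group.generate_inv_generator[OF group_PSL2C] proj_PSL_closed det_Fmat det_Gmat)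
  qed simp
  obtain t' where t': "t' = t \<or> t' = - t" "B ** N = N ** Gmat t'" using N(3) by blast
  have "PSL2C\<lparr>carrier := generate PSL2C {proj_PSL (Fmat T), proj_PSL (Gmat t')}\<rparr> \<cong>
      PSL2C\<lparr>carrier := generate PSL2C ((\<lambda>h. ?n \<otimes>\<^bsub>PSL2C\<^esub> h \<otimes>\<^bsub>PSL2C\<^esub> inv\<^bsub>PSL2C\<^esub> ?n) `
        {proj_PSL (Fmat T), proj_PSL (Gmat t')})\<rparr>"
    using N(1) by (intro group.conj_generate_iso[OF group_PSL2C]) auto
  also have "(\<lambda>h. ?n \<otimes>\<^bsub>PSL2C\<^esub> h \<otimes>\<^bsub>PSL2C\<^esub> inv\<^bsub>PSL2C\<^esub> ?n) `
        {proj_PSL (Fmat T), proj_PSL (Gmat t')} = {f, g}"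
    using conj[OF N(2) A(1) det_Fmat] conj[OF t'(2) B(1) det_Gmat] A(2) B(2)
    by (simp only: image_insert image_empty)
  finally have "PSL2C\<lparr>carrier := generate PSL2C {proj_PSL (Fmat T), proj_PSL (Gmat t)}\<rparr> \<cong>
      PSL2C\<lparr>carrier := generate PSL2C {f, g}\<rparr>"
    unfolding gen[OF t'(1)] .
  moreover have "group (PSL2C\<lparr>carrier := generate PSL2C {proj_PSL (Fmat T), proj_PSL (Gmat t)}\<rparr>)"
    by (intro proj.H.subgroup_imp_group proj.H.generate_is_subgroup) auto
  ultimately show ?thesis by (rule group.iso_sym[rotated])
qed

section \<open>Reading the angles off the parameters\<close>

text \<open>Here \<open>T = sqrt (\<beta> + 4)\<close> is the nonnegative trace of \<open>f\<close>: it is \<open>2 cos(\<pi>/k)\<close>, \<open>2\<close>, or above \<open>2\<close>.\<close>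

lemma angle_exponent_of_beta:
  assumes "(\<exists>k::int. k \<ge> 3 \<and> \<beta> = complex_of_real (- 4 * (sin (pi / of_int k))\<^sup>2) \<and> n = Fin k) \<or>
       (\<beta> = 0 \<and> n = Infty) \<or> (\<beta> \<in> complex_of_real ` {0<..} \<and> n = BarInfty)"
  obtains T where "T \<ge> 0" "angle_exponent n (T / 2)" "\<beta> = complex_of_real (T\<^sup>2 - 4)"
  using assms
proof (elim disjE exE conjE)
  fix k :: int
  assume k: "k \<ge> 3" "\<beta> = complex_of_real (- 4 * (sin (pi / of_int k))\<^sup>2)" "n = Fin k"
  define m where "m = nat k"
  have m: "k = int m" "m \<ge> 3" using k(1) by (simp_all add: m_def)
  define \<theta> where "\<theta> = pi / real m"
  have "real m \<ge> 2" using m(2) by simp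
  then have \<theta>: "0 < \<theta>" "\<theta> \<le> pi / 2" unfolding \<theta>_def by (simp_all add: field_simps)
  have "cos \<theta> \<ge> 0" using \<theta> by (intro cos_ge_zero) auto
  moreover have "angle_exponent n (2 * cos \<theta> / 2)"
    unfolding angle_exponent_def using k(3) m by (auto simp: \<theta>_def)
  moreover have "- 4 * (sin \<theta>)\<^sup>2 = (2 * cos \<theta>)\<^sup>2 - 4"
    by (simp add: sin_squared_eq power_mult_distrib)
  then have "\<beta> = complex_of_real ((2 * cos \<theta>)\<^sup>2 - 4)"
    using k(2) m(1) by (simp only: \<theta>_def of_int_of_nat_eq)
  ultimately show thesis using that[of "2 * cos \<theta>"] by simp
next
  assume "\<beta> = 0" "n = Infty"
  then show thesis using that[of 2] by (simp add: angle_exponent_def)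
next
  assume b: "\<beta> \<in> complex_of_real ` {0<..}" "n = BarInfty"
  then obtain r where r: "r > 0" "\<beta> = complex_of_real r" by auto
  have "sqrt 4 \<le> sqrt (r + 4)" using r(1) by (intro real_sqrt_le_mono) simp
  then show thesis using that[of "sqrt (r + 4)"] r b(2) by (simp add: angle_exponent_def)
qed

lemma angle_of_gamma:
  fixes p :: int
  assumes "p \<ge> 3"
  obtains m where "p = int m" "m \<ge> 3" "cos (pi / real m) > 0"
    "- 4 * (cos (pi / of_int p))\<^sup>2 = - (2 * cos (pi / real m))\<^sup>2"
proof -
  define m where "m = nat p"
  have m: "p = int m" "m \<ge> 3" using assms by (simp_all add: m_def)
  then have "pi / real m < pi / 2" by (intro divide_strict_left_mono) auto
  moreover have "pi / real m > 0" using m(2) by simp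
  ultimately have "cos (pi / real m) > 0" by (intro cos_gt_zero) auto
  then show thesis using that[OF m] m(1) by (simp add: power_mult_distrib)
qed

theorem theorem3p1:
  fixes f g :: "mat2 set" and \<Gamma> :: "mat2 set set" and n :: exponent
  assumes RP: "RP_pair f g"
    and Gamma: "\<Gamma> = generate PSL2C {f, g}"
    and nonelementary: "\<not> elementary \<Gamma>"
    and discrete: "discrete_subset \<Gamma>"
    and no_plane: "\<not> has_invariant_plane \<Gamma>"
    and beta_g: "beta g = 0"
    and beta_f:
      "(\<exists>k::int. k \<ge> 3 \<and> beta f = complex_of_real (- 4 * (sin (pi / of_int k))\<^sup>2) \<and> n = Fin k) \<or>
       (beta f = 0 \<and> n = Infty) \<or>
       (beta f \<in> complex_of_real ` {0<..} \<and> n = BarInfty)"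
  shows "(gamma f g \<in> complex_of_real ` {..< -4} \<longrightarrow>
            PSL2C\<lparr>carrier := \<Gamma>\<rparr> \<cong> GT n Infty BarInfty) \<and>
         (gamma f g = - 4 \<longrightarrow>
            PSL2C\<lparr>carrier := \<Gamma>\<rparr> \<cong> GT n Infty Infty) \<and>
         (\<forall>p::int. p \<ge> 4 \<and> even p \<and>
            gamma f g = complex_of_real (- 4 * (cos (pi / of_int p))\<^sup>2) \<longrightarrow>
            PSL2C\<lparr>carrier := \<Gamma>\<rparr> \<cong> GT n Infty (Fin (p div 2))) \<and>
         (\<forall>p::int. p \<ge> 3 \<and> odd p \<and>
            gamma f g = complex_of_real (- 4 * (cos (pi / of_int p))\<^sup>2) \<longrightarrow>
            PSL2C\<lparr>carrier := \<Gamma>\<rparr> \<cong> Tet n Infty (Fin p))"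
proof -
  have fg: "f \<in> carrier PSL2C" "g \<in> carrier PSL2C" using RP by (simp_all add: RP_pair_def)
  obtain T where T: "T \<ge> 0" "angle_exponent n (T / 2)" "beta f = complex_of_real (T\<^sup>2 - 4)"
    using angle_exponent_of_beta[OF beta_f] .
  have normal: "PSL2C\<lparr>carrier := \<Gamma>\<rparr> \<cong> H"
    if t: "t > 0" "gamma f g = - complex_of_real (t\<^sup>2)"
      and H: "PSL2C\<lparr>carrier := generate PSL2C {proj_PSL (Fmat T), proj_PSL (Gmat t)}\<rparr> \<cong> H"
    for t and H :: "'a gword set monoid"
    using generate_iso_normal_form[OF fg T(3) beta_g t(2)] t(1) H
    unfolding Gamma by (auto intro: iso_trans)
  have GT: "PSL2C\<lparr>carrier := \<Gamma>\<rparr> \<cong> GT n Infty e"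
    if "t > 0" "gamma f g = - complex_of_real (t\<^sup>2)"
      and "(\<exists>q::nat. q \<ge> 2 \<and> e = Fin (int q) \<and> t / 2 = cos (pi / real (2 * q))) \<or>
        ((e = Infty \<or> e = BarInfty) \<and> t / 2 \<ge> 1)" for t e
  proof -
    interpret GT_rep T t n e using T that by unfold_locales auto
    show ?thesis using normal[OF that(1,2) GT_iso] .
  qed
  show ?thesis
  proof (intro conjI impI allI; (elim conjE)?)
    assume "gamma f g \<in> complex_of_real ` {..< -4}"
    then obtain r where r: "r < - 4" "gamma f g = complex_of_real r" by auto
    have "sqrt 4 \<le> sqrt (- r)" using r(1) by (intro real_sqrt_le_mono) simp
    then show "PSL2C\<lparr>carrier := \<Gamma>\<rparr> \<cong> GT n Infty BarInfty"
      using r by (intro GT[of "sqrt (- r)"]) auto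
  next
    assume "gamma f g = - 4"
    then show "PSL2C\<lparr>carrier := \<Gamma>\<rparr> \<cong> GT n Infty Infty"
      by (intro GT[of 2]) auto
  next
    fix p :: int
    assume p: "p \<ge> 4" "even p" "gamma f g = complex_of_real (- 4 * (cos (pi / of_int p))\<^sup>2)"
    have "p \<ge> 3" using p(1) by simp
    then obtain m where m: "p = int m" "cos (pi / real m) > 0"
      "- 4 * (cos (pi / of_int p))\<^sup>2 = - (2 * cos (pi / real m))\<^sup>2"
      using angle_of_gamma by blast
    have "even m" using p(2) m(1) by simp
    then obtain q where q: "m = 2 * q" by blast
    have "gamma f g = - complex_of_real ((2 * cos (pi / real m))\<^sup>2)"
      unfolding p(3) m(3) by simp
    moreover have "q \<ge> 2" "p div 2 = int q" using p(1) m(1) q by simp_all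
    ultimately show "PSL2C\<lparr>carrier := \<Gamma>\<rparr> \<cong> GT n Infty (Fin (p div 2))"
      using m(2) q by (intro GT[of "2 * cos (pi / real m)"]) auto
  next
    fix p :: int
    assume p: "p \<ge> 3" "odd p" "gamma f g = complex_of_real (- 4 * (cos (pi / of_int p))\<^sup>2)"
    obtain m where m: "p = int m" "m \<ge> 3" "cos (pi / real m) > 0"
      "- 4 * (cos (pi / of_int p))\<^sup>2 = - (2 * cos (pi / real m))\<^sup>2"
      using angle_of_gamma[OF p(1)] .
    have "odd m" using p(2) m(1) by simp
    then obtain k where k: "m = 2 * k + 1" by (rule oddE)
    \<comment> \<open>Then \<open>\<gamma> = - ?t\<^sup>2\<close> and the mirrors \<open>S\<close> and \<open>C\<close> meet at the angle \<open>\<pi>/p\<close>.\<close>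
    let ?t = "2 * cos (pi / real m)"
    have "angle_exponent (Fin p) (?t / 2)"
      unfolding angle_exponent_def using m by auto
    then interpret Tet_rep T ?t n "Fin p"
      using T m(3) by unfold_locales auto
    have "gamma f g = - complex_of_real (?t\<^sup>2)" unfolding p(3) m(4) by simp
    moreover have "Fin p = Fin (int (2 * k + 1))" by (simp only: m(1) k)
    ultimately show "PSL2C\<lparr>carrier := \<Gamma>\<rparr> \<cong> Tet n Infty (Fin p)"
      using normal[OF t_pos _ Tet_iso_odd] by blast
  qed
qed

end
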